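(* There is an exact algorithm for HL$_1$ on trees with running time $n^{O(\log n)}$: given a tree $T$ on $n$ vertices, it outputs a hub labeling $H$ of $T$ minimizing $\sum_u|H_u|$.
   Context: For a tree $T=(V,E)$ and $u,v\in V$, let $P_{uv}$ be the vertex set of the unique $u$–$v$ path ($P_{uu}=\{u\}$). A hub labeling of $T$ is a family $\{H_u\}_{u\in V}$ of subsets of $V$ with $H_u\cap H_v\cap P_{uv}\neq\varnothing$ for all $u,v\in V$ (including $u=v$). HL$_1$ is the problem of minimizing $\sum_{u\in V}|H_u|$. *)

theory Defs
  imports "HOL-Library.Landau_Symbols"
begin

section \<open>Trees and hub labelings\<close>

definition simple_graph :: "'a set \<Rightarrow> 'a set set \<Rightarrow> bool" where
  "simple_graph V E \<longleftrightarrow> finite V \<and> (\<forall>e\<in>E. \<exists>u\<in>V. \<exists>v\<in>V. u \<noteq> v \<and> e = {u, v})"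

definition simple_path :: "'a set \<Rightarrow> 'a set set \<Rightarrow> 'a \<Rightarrow> 'a list \<Rightarrow> 'a \<Rightarrow> bool" where
  "simple_path V E u p v \<longleftrightarrow>
     p \<noteq> [] \<and> hd p = u \<and> last p = v \<and> distinct p \<and> set p \<subseteq> V \<and>
     successively (\<lambda>x y. {x, y} \<in> E) p"

definition simple_cycle :: "'a set \<Rightarrow> 'a set set \<Rightarrow> 'a list \<Rightarrow> bool" where
  "simple_cycle V E p \<longleftrightarrow>
     length p \<ge> 3 \<and> distinct p \<and> set p \<subseteq> V \<and>
     successively (\<lambda>x y. {x, y} \<in> E) p \<and> {last p, hd p} \<in> E"

definition is_tree :: "'a set \<Rightarrow> 'a set set \<Rightarrow> bool" where
  "is_tree V E \<longleftrightarrow>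
     simple_graph V E \<and> V \<noteq> {} \<and>
     (\<forall>u\<in>V. \<forall>v\<in>V. \<exists>p. simple_path V E u p v) \<and>
     (\<nexists>p. simple_cycle V E p)"

definition tree_path :: "'a set \<Rightarrow> 'a set set \<Rightarrow> 'a \<Rightarrow> 'a \<Rightarrow> 'a set" where
  "tree_path V E u v = set (THE p. simple_path V E u p v)"

definition hub_labeling :: "'a set \<Rightarrow> 'a set set \<Rightarrow> ('a \<Rightarrow> 'a set) \<Rightarrow> bool" where
  "hub_labeling V E H \<longleftrightarrow>
     (\<forall>u\<in>V. H u \<subseteq> V) \<and>
     (\<forall>u\<in>V. \<forall>v\<in>V. H u \<inter> H v \<inter> tree_path V E u v \<noteq> {})"

definition HL1_cost :: "'a set \<Rightarrow> ('a \<Rightarrow> 'a set) \<Rightarrow> nat" where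
  "HL1_cost V H = (\<Sum>u\<in>V. card (H u))"

definition optimal_HL1 :: "'a set \<Rightarrow> 'a set set \<Rightarrow> ('a \<Rightarrow> 'a set) \<Rightarrow> bool" where
  "optimal_HL1 V E H \<longleftrightarrow>
     hub_labeling V E H \<and>
     (\<forall>H'. hub_labeling V E H' \<longrightarrow> HL1_cost V H \<le> HL1_cost V H')"

section \<open>Model of computation\<close>

text \<open>
  A program is a finite list of (mutually recursive) first-order functions over binary trees with
  natural numbers at the leaves, evaluated call by value. Every evaluated node of the syntax tree
  costs one step. With values represented as pointers into shared memory, each step is a
  constant number of pointer operations, or one addition, truncated subtraction or comparison of
  numbers. There is no multiplication and no deep equality test, so after \<open>t\<close> steps all numbers
  have \<open>O(t)\<close> bits more than those in the program and its input, and running times agree with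
  those of Turing machines and random access machines up to a polynomial.
\<close>

datatype val = Atom nat | Cell val val

datatype op1 = Fst | Snd | IsCell

datatype op2 = MkCell | Add | Sub | Leq

text \<open>\<open>Var i\<close> is a de Bruijn index into the environment; \<open>Call f e\<close> calls the \<open>f\<close>-th
  function of the program, whose body sees exactly one variable, its argument.\<close>

datatype exp =
    Var nat
  | Const nat
  | Op1 op1 exp
  | Op2 op2 exp exp
  | IfZero exp exp exp
  | LetIn exp exp
  | Call nat exp

type_synonym program = "exp list"

fun num_of :: "val \<Rightarrow> nat" where
  "num_of (Atom n) = n"
| "num_of (Cell _ _) = 0"

text \<open>Operations are total; on ill-typed arguments they use the default \<open>Atom 0\<close>.\<close>

fun apply1 :: "op1 \<Rightarrow> val \<Rightarrow> val" where
  "apply1 Fst (Cell a b) = a"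
| "apply1 Fst (Atom n) = Atom 0"
| "apply1 Snd (Cell a b) = b"
| "apply1 Snd (Atom n) = Atom 0"
| "apply1 IsCell (Cell a b) = Atom 1"
| "apply1 IsCell (Atom n) = Atom 0"

fun apply2 :: "op2 \<Rightarrow> val \<Rightarrow> val \<Rightarrow> val" where
  "apply2 MkCell a b = Cell a b"
| "apply2 Add a b = Atom (num_of a + num_of b)"
| "apply2 Sub a b = Atom (num_of a - num_of b)"
| "apply2 Leq a b = Atom (if num_of a \<le> num_of b then 1 else 0)"

text \<open>\<open>evaluates P env e v t\<close>: in environment \<open>env\<close>, the evaluation of \<open>e\<close> terminates with
  value \<open>v\<close> after exactly \<open>t\<close> steps.\<close>

inductive evaluates :: "program \<Rightarrow> val list \<Rightarrow> exp \<Rightarrow> val \<Rightarrow> nat \<Rightarrow> bool"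
  for P :: program where
  Var: "i < length env \<Longrightarrow> evaluates P env (Var i) (env ! i) 1"
| Const: "evaluates P env (Const n) (Atom n) 1"
| Op1: "evaluates P env e v t \<Longrightarrow> evaluates P env (Op1 f e) (apply1 f v) (t + 1)"
| Op2: "\<lbrakk>evaluates P env e1 v1 t1; evaluates P env e2 v2 t2\<rbrakk>
    \<Longrightarrow> evaluates P env (Op2 f e1 e2) (apply2 f v1 v2) (t1 + t2 + 1)"
| IfZero_True: "\<lbrakk>evaluates P env b (Atom 0) t1; evaluates P env e1 v t2\<rbrakk>
    \<Longrightarrow> evaluates P env (IfZero b e1 e2) v (t1 + t2 + 1)"
| IfZero_False: "\<lbrakk>evaluates P env b w t1; w \<noteq> Atom 0; evaluates P env e2 v t2\<rbrakk>
    \<Longrightarrow> evaluates P env (IfZero b e1 e2) v (t1 + t2 + 1)"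
| LetIn: "\<lbrakk>evaluates P env e1 w t1; evaluates P (w # env) e2 v t2\<rbrakk>
    \<Longrightarrow> evaluates P env (LetIn e1 e2) v (t1 + t2 + 1)"
| Call: "\<lbrakk>evaluates P env e w t1; f < length P; evaluates P [w] (P ! f) v t2\<rbrakk>
    \<Longrightarrow> evaluates P env (Call f e) v (t1 + t2 + 1)"

lemma evaluates_deterministic:
  "evaluates P env e v t \<Longrightarrow> evaluates P env e v' t' \<Longrightarrow> v' = v \<and> t' = t"
proof (induction arbitrary: v' t' rule: evaluates.induct)
  case (Var i env)
  from Var.prems show ?case by cases auto
next
  case (Const env n)
  from Const.prems show ?case by cases auto
next
  case (Op1 env e v t f)
  from Op1.prems show ?case by cases (use Op1.IH in auto)
next
  case (Op2 env e1 v1 t1 e2 v2 t2 f)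
  from Op2.prems show ?case by cases (use Op2.IH in blast)
next
  case (IfZero_True env b t1 e1 v t2 e2)
  from IfZero_True.prems show ?case by cases (use IfZero_True.IH in blast)+
next
  case (IfZero_False env b w t1 e2 v t2 e1)
  from IfZero_False.prems show ?case
    by cases (use IfZero_False.IH IfZero_False.hyps in blast)+
next
  case (LetIn env e1 w t1 e2 v t2)
  from LetIn.prems show ?case by cases (use LetIn.IH in blast)
next
  case (Call env e w t1 f v t2)
  from Call.prems show ?case by cases (use Call.IH in blast)
qed

definition runs :: "program \<Rightarrow> val \<Rightarrow> val \<Rightarrow> nat \<Rightarrow> bool" where
  "runs P inp out t \<longleftrightarrow> evaluates P [inp] (Call 0 (Var 0)) out t"

section \<open>Encoding of instances and solutions\<close>

fun enc_list :: "val list \<Rightarrow> val" where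
  "enc_list [] = Atom 0"
| "enc_list (x # xs) = Cell x (enc_list xs)"

text \<open>Instances have vertex set \<open>{..<n}\<close>. A list of pairs represents the edge set if it contains
  each edge exactly once, in arbitrary order and orientation.\<close>

definition represents_edges :: "(nat \<times> nat) list \<Rightarrow> nat set set \<Rightarrow> bool" where
  "represents_edges es E \<longleftrightarrow>
     distinct (map (\<lambda>(a, b). {a, b}) es) \<and> set (map (\<lambda>(a, b). {a, b}) es) = E"

definition enc_graph :: "nat \<Rightarrow> (nat \<times> nat) list \<Rightarrow> val" where
  "enc_graph n es = Cell (Atom n) (enc_list (map (\<lambda>(a, b). Cell (Atom a) (Atom b)) es))"

text \<open>The output lists, for \<open>u = 0, \<dots>, n - 1\<close>, the elements of \<open>H u\<close> without repetition.\<close>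

definition represents_labeling :: "nat \<Rightarrow> val \<Rightarrow> (nat \<Rightarrow> nat set) \<Rightarrow> bool" where
  "represents_labeling n out H \<longleftrightarrow>
     (\<exists>ls. out = enc_list (map (\<lambda>l. enc_list (map Atom l)) ls) \<and> length ls = n \<and>
           (\<forall>u<n. distinct (ls ! u) \<and> set (ls ! u) = H u))"

definition solves_HL1_on_trees :: "program \<Rightarrow> (nat \<Rightarrow> nat) \<Rightarrow> bool" where
  "solves_HL1_on_trees P T \<longleftrightarrow>
     (\<forall>n E es. is_tree {..<n} E \<longrightarrow> represents_edges es E \<longrightarrow>
        (\<exists>out t H. runs P (enc_graph n es) out t \<and> t \<le> T n \<and>
                   represents_labeling n out H \<and> optimal_HL1 {..<n} E H))"

end

theory Submission
  imports Defs "HOL-Library.Multiset"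
begin

text \<open>
  Every hub labeling \<open>H\<close> of a tree \<open>S\<close> has a vertex \<open>r\<close> such that adding \<open>r\<close> to all hub sets and
  then restricting each hub set to \<open>r\<close> and the component of \<open>S - r\<close> it belongs to does not increase
  the cost, by a Helly argument. So the optimum is \<open>|S|\<close> plus the minimum over \<open>r\<close> of the summed
  optima of the components of \<open>S - r\<close>. Along four optimal choices \<open>r\<close> in succession the
  component shrinks to at most \<open>3/4\<close> of its size, since otherwise four hubs would be common to more
  than \<open>3/4\<close> of the vertices and adding a centroid to all hub sets would make the labeling cheaper.
  As \<open>(3/4)^3 < 1/2\<close>, the plain recursion over all \<open>r\<close> and all components may stop at depth
  \<open>12 L\<close> where \<open>n < 2 ^ L\<close>; every level costs a factor polynomial in \<open>n\<close>.
\<close>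

section \<open>Paths in trees\<close>

text \<open>The obstacle is balance. The Helly argument finds an optimal root but gives no control
  over how evenly it splits the set, so progress is measured over several removals. All roots
  removed on the way to a component C are hubs of every vertex of C in one optimal labeling of the
  starting set S, because optimal labelings of components can be glued freely. With k such roots,
  pushing a centroid adds at most |S| hubs and deletes at least k (|C| - |S|/2), so optimality
  forces |C| \<le> (1/2 + 1/k) |S|. The algorithm never recognises an optimal root; trying all roots
  replaces that knowledge. Cutting the recursion off is harmless since an exhausted branch still
  returns a valid labeling: it may overestimate the optimum of a component but never undercut it. It
  is enough that the choices through optimal roots are solved exactly, and along those the set is
  used up before the fuel is.\<close>

lemma simple_path_start: "simple_path S E u p v \<Longrightarrow> u \<in> set p"
  by (auto simp: simple_path_def)

lemma simple_path_subset: "simple_path S E u p v \<Longrightarrow> set p \<subseteq> S"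
  by (auto simp: simple_path_def)

lemma simple_path_mono: "simple_path S E u p v \<Longrightarrow> set p \<subseteq> S' \<Longrightarrow> simple_path S' E u p v"
  by (auto simp: simple_path_def)

lemma simple_path_singleton: "u \<in> S \<Longrightarrow> simple_path S E u [u] u"
  by (auto simp: simple_path_def)

lemma simple_path_rev: "simple_path S E u p v \<Longrightarrow> simple_path S E v (rev p) u"
  by (auto simp: simple_path_def hd_rev last_rev successively_rev insert_commute)

lemma simple_path_Cons:
  "simple_path S E x p v \<Longrightarrow> {u, x} \<in> E \<Longrightarrow> u \<in> S \<Longrightarrow> u \<notin> set p \<Longrightarrow> simple_path S E u (u # p) v"
  by (cases p) (auto simp: simple_path_def)

lemma simple_path_suffix:
  assumes "simple_path S E u (xs @ x # ys) v"
  shows "simple_path S E x (x # ys) v"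
  using assms by (auto simp: simple_path_def successively_append_iff)

lemma simple_path_prefix:
  assumes "simple_path S E u (xs @ x # ys) v"
  shows "simple_path S E u (xs @ [x]) x"
  using assms by (auto simp: simple_path_def successively_append_iff hd_append split: if_splits)

lemma simple_path_edge_extend:
  assumes "simple_path S E x p v" "{u, x} \<in> E" "u \<in> S"
  obtains q where "simple_path S E u q v"
proof (cases "u \<in> set p")
  case True
  then obtain xs ys where "p = xs @ u # ys" by (meson split_list)
  then show ?thesis using assms(1) simple_path_suffix that by metis
next
  case False
  then show ?thesis using simple_path_Cons[OF assms] that by blast
qed

text \<open>Vertices of \<open>p\<close> are prepended from the back; one that has been visited
  already cuts the path at its earlier occurrence, so the result stays simple. The vertex set
  \<open>S\<close> is a parameter because it confines the joined path: later uses take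
  \<open>V - {u}\<close> or the union of two paths.\<close>

lemma simple_path_trans:
  assumes "simple_path S E u p v" "simple_path S E v q w"
  shows "\<exists>r. simple_path S E u r w"
  using assms(1)
proof (induction p arbitrary: u)
  case Nil
  then show ?case by (simp add: simple_path_def)
next
  case (Cons a p)
  have a: "a = u" "u \<in> S" using Cons.prems by (auto simp: simple_path_def)
  show ?case
  proof (cases p)
    case Nil
    then have "u = v" using Cons.prems by (auto simp: simple_path_def)
    then show ?thesis using assms(2) by blast
  next
    case (Cons b p')
    have "simple_path S E b p v" "{u, b} \<in> E"
      using Cons.prems Cons a by (auto simp: simple_path_def)
    with Cons.IH[of b] obtain r where "simple_path S E b r w" by blast
    then show ?thesis
      using simple_path_edge_extend[OF _ \<open>{u, b} \<in> E\<close> \<open>u \<in> S\<close>] by metis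
  qed
qed

text \<open>Where two paths from \<open>u\<close> to \<open>v\<close> first diverge, their remainders join up to a path that
  closes a cycle.\<close>

lemma simple_path_unique:
  assumes acyc: "\<nexists>c. simple_cycle V E c"
  shows "simple_path V E u p v \<Longrightarrow> simple_path V E u q v \<Longrightarrow> p = q"
proof (induction p arbitrary: u q)
  case Nil
  then show ?case by (simp add: simple_path_def)
next
  case (Cons a p)
  have a: "a = u" "u \<in> V" using Cons.prems by (auto simp: simple_path_def)
  obtain q' where q: "q = u # q'" using Cons.prems(2) by (cases q) (auto simp: simple_path_def)
  show ?case
  proof (cases "p = [] \<or> q' = []")
    case True
    then have "u = v" using Cons.prems a q by (auto simp: simple_path_def)
    then show ?thesis using Cons.prems a q by (auto simp: simple_path_def split: if_splits)
  next
    case False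
    define x y where "x = hd p" and "y = hd q'"
    have p: "simple_path V E x p v" "{u, x} \<in> E" "u \<notin> set p"
      using Cons.prems False a by (auto simp: simple_path_def x_def successively_Cons)
    have q': "simple_path V E y q' v" "{u, y} \<in> E" "u \<notin> set q'"
      using Cons.prems False q by (auto simp: simple_path_def y_def successively_Cons)
    have "x = y"
    proof (rule ccontr)
      assume "x \<noteq> y"
      have "simple_path (V - {u}) E x p v" "simple_path (V - {u}) E v (rev q') y"
        using p q' simple_path_rev[OF q'(1)] by (auto simp: simple_path_def)
      then obtain r where r: "simple_path (V - {u}) E x r y" by (meson simple_path_trans)
      have "length r \<ge> 2"
      proof -
        have "r \<noteq> []" "hd r = x" "last r = y" using r by (auto simp: simple_path_def)
        then show ?thesis using \<open>x \<noteq> y\<close> by (cases r; cases "tl r") auto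
      qed
      then have "simple_cycle V E (u # r)"
        using r p(2) q'(2) a
        by (auto simp: simple_cycle_def simple_path_def successively_Cons insert_commute)
      then show False using acyc by blast
    qed
    then show ?thesis using Cons.IH p q' a q by simp
  qed
qed

section \<open>Path systems: tree paths as vertex sets\<close>

text \<open>The properties of tree paths on which the combinatorial argument rests. In
  \<open>P_next\<close> the witness \<open>y\<close> is the neighbour of \<open>r\<close> towards
  \<open>u\<close>: whatever is reached from \<open>y\<close> without \<open>r\<close> is reached
  from \<open>r\<close> through \<open>y\<close>.\<close>

locale path_system =
  fixes V :: "'a set" and P :: "'a \<Rightarrow> 'a \<Rightarrow> 'a set"
  assumes finite_V: "finite V"
    and P_self: "u \<in> V \<Longrightarrow> P u u = {u}"
    and P_sym: "u \<in> V \<Longrightarrow> v \<in> V \<Longrightarrow> P u v = P v u"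
    and P_start: "u \<in> V \<Longrightarrow> v \<in> V \<Longrightarrow> u \<in> P u v"
    and P_subset: "u \<in> V \<Longrightarrow> v \<in> V \<Longrightarrow> P u v \<subseteq> V"
    and P_trans: "u \<in> V \<Longrightarrow> v \<in> V \<Longrightarrow> w \<in> V \<Longrightarrow> P u w \<subseteq> P u v \<union> P v w"
    and P_prefix: "u \<in> V \<Longrightarrow> v \<in> V \<Longrightarrow> x \<in> P u v \<Longrightarrow> P u x \<subseteq> P u v"
    and P_next: "r \<in> V \<Longrightarrow> u \<in> V \<Longrightarrow> r \<noteq> u \<Longrightarrow>
      \<exists>y\<in>P r u. r \<notin> P y u \<and> (\<forall>w\<in>V. r \<notin> P y w \<longrightarrow> y \<in> P r w)"

lemma tree_path_eq:
  assumes "is_tree V E" "simple_path V E u p v"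
  shows "tree_path V E u v = set p"
proof -
  have "(THE p. simple_path V E u p v) = p"
    using assms simple_path_unique unfolding is_tree_def by (metis (mono_tags, lifting) the_equality)
  then show ?thesis by (simp add: tree_path_def)
qed

lemma ex_tree_path:
  assumes "is_tree V E" "u \<in> V" "v \<in> V"
  shows "\<exists>p. simple_path V E u p v \<and> tree_path V E u v = set p"
  using assms tree_path_eq[OF assms(1)] unfolding is_tree_def by metis

lemma tree_path_edge:
  assumes "is_tree V E" "{a, b} \<in> E"
  shows "tree_path V E a b = {a, b}"
proof -
  have "a \<in> V" "b \<in> V" "a \<noteq> b"
    using assms unfolding is_tree_def simple_graph_def by (force simp: doubleton_eq_iff)+
  then have "simple_path V E a [a, b] b" using assms by (auto simp: simple_path_def)
  then show ?thesis using tree_path_eq[OF assms(1)] by force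
qed

lemma path_system_tree_path:
  assumes T: "is_tree V E"
  shows "path_system V (tree_path V E)"
proof
  show "finite V" using T by (simp add: is_tree_def simple_graph_def)
  show "tree_path V E u u = {u}" if "u \<in> V" for u
    using tree_path_eq[OF T simple_path_singleton[OF that]] by simp
  show "tree_path V E u v = tree_path V E v u" if "u \<in> V" "v \<in> V" for u v
    using ex_tree_path[OF T that] simple_path_rev tree_path_eq[OF T] by (metis set_rev)
  show "u \<in> tree_path V E u v" if "u \<in> V" "v \<in> V" for u v
    using ex_tree_path[OF T that] simple_path_start by metis
  show "tree_path V E u v \<subseteq> V" if "u \<in> V" "v \<in> V" for u v
    using ex_tree_path[OF T that] simple_path_subset by metis
  show "tree_path V E u w \<subseteq> tree_path V E u v \<union> tree_path V E v w"
    if uvw: "u \<in> V" "v \<in> V" "w \<in> V" for u v w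
  proof -
    obtain p where p: "simple_path V E u p v" "tree_path V E u v = set p"
      using ex_tree_path[OF T] uvw by metis
    obtain q where q: "simple_path V E v q w" "tree_path V E v w = set q"
      using ex_tree_path[OF T] uvw by metis
    \<comment> \<open>Joining the paths inside the union of their vertex sets keeps the result
      there; uniqueness then identifies it with the tree path.\<close>
    have "simple_path (set p \<union> set q) E u p v" "simple_path (set p \<union> set q) E v q w"
      using p q by (auto intro: simple_path_mono)
    then obtain r where r: "simple_path (set p \<union> set q) E u r w" by (meson simple_path_trans)
    have sub: "set r \<subseteq> set p \<union> set q" using simple_path_subset[OF r] .
    moreover have "simple_path V E u r w"
      using r sub p q by (meson simple_path_mono simple_path_subset le_sup_iff order_trans)
    ultimately show ?thesis using tree_path_eq[OF T] p q by metis
  qed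
  show "tree_path V E u x \<subseteq> tree_path V E u v"
    if uvx: "u \<in> V" "v \<in> V" "x \<in> tree_path V E u v" for u v x
  proof -
    obtain p where p: "simple_path V E u p v" "tree_path V E u v = set p"
      using ex_tree_path[OF T] uvx by metis
    then obtain xs ys where "p = xs @ x # ys" using \<open>x \<in> tree_path V E u v\<close> by (metis split_list)
    then show ?thesis using simple_path_prefix tree_path_eq[OF T] p by fastforce
  qed
  show "\<exists>y\<in>tree_path V E r u. r \<notin> tree_path V E y u \<and>
      (\<forall>w\<in>V. r \<notin> tree_path V E y w \<longrightarrow> y \<in> tree_path V E r w)"
    if ru: "r \<in> V" "u \<in> V" "r \<noteq> u" for r u
  proof -
    obtain p where p: "simple_path V E r p u" "tree_path V E r u = set p"
      using ex_tree_path[OF T] ru by metis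
    obtain y ys where ys: "p = r # y # ys"
      using p(1) \<open>r \<noteq> u\<close> by (cases p; cases "tl p") (auto simp: simple_path_def)
    have y: "simple_path V E y (y # ys) u" "{r, y} \<in> E" "r \<notin> set (y # ys)" "y \<in> V"
      using p(1) ys by (auto simp: simple_path_def)
    have "y \<in> tree_path V E r w" if w: "w \<in> V" "r \<notin> tree_path V E y w" for w
    proof -
      obtain q where q: "simple_path V E y q w" "tree_path V E y w = set q"
        using ex_tree_path[OF T] w y by metis
      have "simple_path V E r (r # q) w"
        using simple_path_Cons[OF q(1) y(2) \<open>r \<in> V\<close>] q(2) w by simp
      then show ?thesis using tree_path_eq[OF T] simple_path_start[OF q(1)] by fastforce
    qed
    then show ?thesis using p ys y tree_path_eq[OF T y(1)] by (intro bexI[of _ y]) auto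
  qed
qed

section \<open>Structure of optimal hub labelings\<close>

context path_system
begin

section \<open>Convex sets, components and centroids\<close>

definition convex :: "'a set \<Rightarrow> bool" where
  "convex S \<longleftrightarrow> S \<subseteq> V \<and> (\<forall>u\<in>S. \<forall>v\<in>S. P u v \<subseteq> S)"

text \<open>The component of \<open>S - {r}\<close> containing \<open>u\<close>; empty if \<open>u = r\<close>.\<close>

definition comp :: "'a set \<Rightarrow> 'a \<Rightarrow> 'a \<Rightarrow> 'a set" where
  "comp S r u = {w \<in> S. r \<notin> P u w}"

lemma convex_V: "convex V"
  using P_subset by (auto simp: convex_def)

lemma convex_finite: "convex S \<Longrightarrow> finite S"
  using finite_V finite_subset by (auto simp: convex_def)

lemma P_end: "u \<in> V \<Longrightarrow> v \<in> V \<Longrightarrow> v \<in> P u v"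
  using P_start P_sym by metis

lemma comp_subset: "comp S r u \<subseteq> S"
  by (auto simp: comp_def)

lemma comp_root: "S \<subseteq> V \<Longrightarrow> r \<in> S \<Longrightarrow> comp S r r = {}"
  using P_start by (auto simp: comp_def)

lemma root_notin_comp: "S \<subseteq> V \<Longrightarrow> u \<in> S \<Longrightarrow> r \<notin> comp S r u"
  using P_end by (auto simp: comp_def)

lemma comp_self: "S \<subseteq> V \<Longrightarrow> u \<in> S \<Longrightarrow> u \<noteq> r \<Longrightarrow> u \<in> comp S r u"
  using P_self by (auto simp: comp_def)

text \<open>By \<open>P_trans\<close> and \<open>P_sym\<close>, being joined by a path without
  \<open>r\<close> is an equivalence on \<open>S - {r}\<close>, and the components are its
  classes.\<close>

lemma comp_eq:
  assumes "S \<subseteq> V" "u \<in> S" "w \<in> comp S r u"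
  shows "comp S r w = comp S r u"
proof -
  have V: "u \<in> V" "w \<in> V" "r \<notin> P u w" using assms by (auto simp: comp_def)
  then have "r \<notin> P w u" using P_sym by metis
  have "r \<notin> P w x \<longleftrightarrow> r \<notin> P u x" if "x \<in> V" for x
    using P_trans[of u w x] P_trans[of w u x] V that \<open>r \<notin> P w u\<close> by blast
  then show ?thesis using assms by (auto simp: comp_def)
qed

lemma convex_comp:
  assumes "convex S" "u \<in> S"
  shows "convex (comp S r u)"
  unfolding convex_def
proof (intro conjI ballI subsetI)
  show "x \<in> V" if "x \<in> comp S r u" for x
    using that assms by (auto simp: convex_def comp_def)
  fix w z x
  assume w: "w \<in> comp S r u" and z: "z \<in> comp S r u" and x: "x \<in> P w z"
  have "x \<in> S" using w z x assms(1) comp_subset unfolding convex_def by blast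
  then have V: "u \<in> V" "w \<in> V" "z \<in> V" "x \<in> V" "x \<in> S"
    using w z assms comp_subset unfolding convex_def by blast+
  have "z \<in> comp S r w" using comp_eq w z assms by (auto simp: convex_def)
  then have "r \<notin> P w z" by (auto simp: comp_def)
  then have "x \<in> comp S r w" using V P_prefix[of w z x] x by (auto simp: comp_def)
  then show "x \<in> comp S r u" using comp_eq w assms by (auto simp: convex_def)
qed

text \<open>If every vertex had a component satisfying \<open>Z\<close> attached to it, choose a minimal one, attached
  to \<open>r\<close>, say, and move from \<open>r\<close> to its neighbour \<open>y\<close> inside it. The \<open>Z\<close>-component attached to \<open>y\<close>
  is either smaller or disjoint from the chosen one.\<close>

lemma ex_vertex_avoiding:
  assumes S: "convex S" "S \<noteq> {}"
    and meet: "\<And>A B. Z A \<Longrightarrow> Z B \<Longrightarrow> A \<inter> B \<noteq> {}"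
  shows "\<exists>r\<in>S. \<forall>u\<in>S. u \<noteq> r \<longrightarrow> \<not> Z (comp S r u)"
proof (rule ccontr)
  assume "\<not> ?thesis"
  then have bad: "\<exists>u\<in>S. u \<noteq> r \<and> Z (comp S r u)" if "r \<in> S" for r
    using that by blast
  define Q where "Q = (\<lambda>(r, u). r \<in> S \<and> u \<in> S \<and> u \<noteq> r \<and> Z (comp S r u))"
  obtain p where "Q p"
    using S(2) bad unfolding Q_def by blast
  then obtain p0 where p0: "Q p0"
    and min: "\<And>q. Q q \<Longrightarrow> card (comp S (fst p0) (snd p0)) \<le> card (comp S (fst q) (snd q))"
    using ex_has_least_nat[of Q p "\<lambda>q. card (comp S (fst q) (snd q))"] by blast
  obtain r u where ru: "p0 = (r, u)" by force
  have r: "r \<in> S" "u \<in> S" "u \<noteq> r" "Z (comp S r u)" using p0 by (auto simp: Q_def ru)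
  have SV: "S \<subseteq> V" using S by (auto simp: convex_def)
  then obtain y where y: "y \<in> P r u" "r \<notin> P y u" "\<And>w. w \<in> V \<Longrightarrow> r \<notin> P y w \<Longrightarrow> y \<in> P r w"
    using P_next[of r u] r by blast
  have yS: "y \<in> S" using y(1) r S(1) unfolding convex_def by blast
  obtain v where v: "v \<in> S" "v \<noteq> y" "Z (comp S y v)" using bad[OF yS] by blast
  obtain w where w: "w \<in> comp S r u" "w \<in> comp S y v" using meet[OF r(4) v(3)] by blast
  have V: "r \<in> V" "u \<in> V" "y \<in> V" "v \<in> V" "w \<in> V"
    using SV r yS v w comp_subset by blast+
  have "y \<in> comp S r u" using y(2) yS V P_sym[of y u] by (auto simp: comp_def)
  have cw: "comp S r w = comp S r u" "comp S y w = comp S y v"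
    using comp_eq SV r v w by blast+
  have "comp S y v \<subset> comp S r u"
  proof
    show "comp S y v \<noteq> comp S r u"
      using root_notin_comp[OF SV v(1)] \<open>y \<in> comp S r u\<close> by blast
    show "comp S y v \<subseteq> comp S r u"
    proof
      fix z assume z: "z \<in> comp S y v"
      then have zV: "z \<in> V" "z \<in> S" using SV comp_subset by blast+
      \<comment> \<open>Otherwise \<open>w\<close> would be reached from \<open>r\<close> avoiding
        \<open>y\<close>, although \<open>w\<close>, reached from \<open>y\<close> avoiding
        \<open>r\<close>, lies behind \<open>y\<close> as seen from \<open>r\<close>.\<close>
      have "r \<notin> comp S y v"
      proof
        assume "r \<in> comp S y v"
        then have "comp S y r = comp S y w" using comp_eq SV v cw by metis
        then have "y \<notin> P r w" using w cw by (auto simp: comp_def)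
        moreover have "r \<notin> P y w"
          using \<open>y \<in> comp S r u\<close> comp_eq[OF SV r(2)] w by (auto simp: comp_def)
        ultimately show False using y(3) V by blast
      qed
      moreover have "comp S y z = comp S y v" using comp_eq[OF SV v(1) z] .
      ultimately have "y \<in> P z r" "y \<notin> P z w" using w r by (auto simp: comp_def)
      \<comment> \<open>If \<open>r\<close> were on the path from \<open>z\<close> to
        \<open>w\<close>, then so would be \<open>y\<close>, which lies between \<open>z\<close> and
        \<open>r\<close>.\<close>
      then have "r \<notin> P z w" using P_prefix[of z w r] V zV by blast
      then have "r \<notin> P w z" using P_sym V zV by metis
      then show "z \<in> comp S r u" using cw zV by (auto simp: comp_def)
    qed
  qed
  moreover have "finite (comp S r u)"
    using convex_finite[OF S(1)] comp_subset finite_subset by metis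
  ultimately have "card (comp S y v) < card (comp S r u)" by (simp add: psubset_card_mono)
  moreover have "card (comp S r u) \<le> card (comp S y v)"
    using min[of "(y, v)"] yS v ru by (auto simp: Q_def)
  ultimately show False by simp
qed

text \<open>Two subsets that each hold more than half of \<open>S\<close> intersect, so being that
  large is an admissible \<open>Z\<close> in \<open>ex_vertex_avoiding\<close>.\<close>

lemma ex_centroid:
  assumes "convex S" "S \<noteq> {}"
  shows "\<exists>c\<in>S. \<forall>u\<in>S. 2 * card (comp S c u) \<le> card S"
proof -
  have SV: "S \<subseteq> V" using assms by (auto simp: convex_def)
  have "\<exists>r\<in>S. \<forall>u\<in>S. u \<noteq> r \<longrightarrow> \<not> (comp S r u \<subseteq> S \<and> card S < 2 * card (comp S r u))"
  proof (rule ex_vertex_avoiding[OF assms])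
    fix A B assume A: "A \<subseteq> S \<and> card S < 2 * card A" and B: "B \<subseteq> S \<and> card S < 2 * card B"
    have fin: "finite S" using convex_finite[OF assms(1)] .
    show "A \<inter> B \<noteq> {}"
    proof
      assume "A \<inter> B = {}"
      moreover have "finite A" "finite B" using A B finite_subset[OF _ fin] by auto
      ultimately have "card A + card B = card (A \<union> B)" by (simp add: card_Un_disjoint)
      also have "\<dots> \<le> card S" using A B fin by (auto intro: card_mono)
      finally show False using A B by linarith
    qed
  qed
  then obtain r where r: "r \<in> S" "\<forall>u\<in>S. u \<noteq> r \<longrightarrow> 2 * card (comp S r u) \<le> card S"
    by (auto simp: comp_subset not_less)
  have "2 * card (comp S r u) \<le> card S" if "u \<in> S" for u
    using that r(2) comp_root[OF SV r(1)] by (cases "u = r") auto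
  then show ?thesis using r by blast
qed

section \<open>Labelings of convex sets and pushing a common hub\<close>

text \<open>For convex \<open>S\<close> the ambient paths stay inside \<open>S\<close>, so this is
  the hub labeling condition of the subtree on \<open>S\<close>, and subproblems can share one path
  function.\<close>

definition labeling :: "'a set \<Rightarrow> ('a \<Rightarrow> 'a set) \<Rightarrow> bool" where
  "labeling S H \<longleftrightarrow> (\<forall>u\<in>S. H u \<subseteq> S \<and> (\<forall>v\<in>S. H u \<inter> H v \<inter> P u v \<noteq> {}))"

abbreviation cost :: "'a set \<Rightarrow> ('a \<Rightarrow> 'a set) \<Rightarrow> nat" where
  "cost \<equiv> HL1_cost"

definition optimal :: "'a set \<Rightarrow> ('a \<Rightarrow> 'a set) \<Rightarrow> bool" where
  "optimal S H \<longleftrightarrow> labeling S H \<and> (\<forall>H'. labeling S H' \<longrightarrow> cost S H \<le> cost S H')"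

definition push :: "'a set \<Rightarrow> 'a \<Rightarrow> ('a \<Rightarrow> 'a set) \<Rightarrow> 'a \<Rightarrow> 'a set" where
  "push S c H v = insert c (H v \<inter> comp S c v)"

lemma labeling_cong: "(\<And>u. u \<in> S \<Longrightarrow> H u = H' u) \<Longrightarrow> labeling S H \<longleftrightarrow> labeling S H'"
  by (auto simp: labeling_def)

lemma cost_cong: "(\<And>u. u \<in> S \<Longrightarrow> H u = H' u) \<Longrightarrow> cost S H = cost S H'"
  by (auto simp: HL1_cost_def)

lemma optimal_cong: "(\<And>u. u \<in> S \<Longrightarrow> H u = H' u) \<Longrightarrow> optimal S H \<longleftrightarrow> optimal S H'"
  using labeling_cong[of S H H'] cost_cong[of S H H'] by (auto simp: optimal_def)

lemma labeling_all: "convex S \<Longrightarrow> labeling S (\<lambda>_. S)"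
  using P_start by (fastforce simp: labeling_def convex_def)

lemma ex_optimal:
  assumes "convex S"
  shows "\<exists>H. optimal S H"
  using ex_has_least_nat[of "labeling S" "\<lambda>_. S" "cost S"] labeling_all[OF assms]
  by (auto simp: optimal_def)

lemma labeling_self:
  assumes "S \<subseteq> V" "labeling S H" "u \<in> S"
  shows "u \<in> H u"
proof -
  have "H u \<inter> H u \<inter> P u u \<noteq> {}" using assms(2,3) unfolding labeling_def by metis
  moreover have "P u u = {u}" using assms(1,3) by (intro P_self) blast
  ultimately show ?thesis by auto
qed

text \<open>The path between two vertices of a component stays in it, so the common hub on that path
  survives the restriction.\<close>

lemma labeling_comp:
  assumes S: "convex S" "labeling S H" and u: "u \<in> S"
  shows "labeling (comp S c u) (\<lambda>v. H v \<inter> comp S c v)"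
  unfolding labeling_def
proof (intro ballI conjI)
  fix v w assume v: "v \<in> comp S c u" and w: "w \<in> comp S c u"
  have SV: "S \<subseteq> V" using S by (auto simp: convex_def)
  have eq: "comp S c v = comp S c u" "comp S c w = comp S c u" using comp_eq[OF SV u] v w by auto
  have "v \<in> S" "w \<in> S" using v w by (auto simp: comp_def)
  then have "H v \<inter> H w \<inter> P v w \<noteq> {}" using S(2) by (simp add: labeling_def)
  moreover have "P v w \<subseteq> comp S c u"
    using convex_comp[OF S(1) u] v w by (auto simp: convex_def)
  ultimately show "(H v \<inter> comp S c v) \<inter> (H w \<inter> comp S c w) \<inter> P v w \<noteq> {}"
    unfolding eq by blast
next
  fix v assume v: "v \<in> comp S c u"
  then show "H v \<inter> comp S c v \<subseteq> comp S c u"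
    using comp_eq[OF _ u v] S by (auto simp: convex_def)
qed

text \<open>Two vertices separated by \<open>c\<close> meet in \<open>c\<close>; all other pairs lie
  in one component and meet by \<open>G\<close>. A single function \<open>G\<close> serves all
  components at once.\<close>

lemma labeling_insert:
  assumes S: "convex S" "c \<in> S" and G: "\<And>u. u \<in> S \<Longrightarrow> u \<noteq> c \<Longrightarrow> labeling (comp S c u) G"
  shows "labeling S (\<lambda>v. insert c (G v \<inter> comp S c v))"
  unfolding labeling_def
proof (intro ballI conjI)
  fix v w assume v: "v \<in> S" and w: "w \<in> S"
  have SV: "S \<subseteq> V" using S by (auto simp: convex_def)
  show "insert c (G v \<inter> comp S c v) \<inter> insert c (G w \<inter> comp S c w) \<inter> P v w \<noteq> {}"
  proof (cases "c \<in> P v w")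
    case True
    then show ?thesis by blast
  next
    case False
    then have "v \<noteq> c" using P_start[of v w] v w SV by auto
    have wv: "w \<in> comp S c v" "v \<in> comp S c v"
      using False w v comp_self[OF SV v \<open>v \<noteq> c\<close>] by (auto simp: comp_def)
    then have "comp S c w = comp S c v" using comp_eq SV v by blast
    moreover have "G v \<inter> G w \<inter> P v w \<noteq> {}" "G v \<subseteq> comp S c v" "G w \<subseteq> comp S c v"
      using G[OF v \<open>v \<noteq> c\<close>] wv by (simp_all add: labeling_def)
    ultimately show ?thesis by blast
  qed
next
  fix v assume "v \<in> S"
  then show "insert c (G v \<inter> comp S c v) \<subseteq> S" using S(2) by (auto simp: comp_def)
qed

lemma labeling_push:
  assumes "convex S" "labeling S H" "c \<in> S"
  shows "labeling S (push S c H)"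
proof -
  have "labeling S (\<lambda>v. insert c ((H v \<inter> comp S c v) \<inter> comp S c v))"
    using labeling_insert[OF assms(1,3)] labeling_comp[OF assms(1,2)] by blast
  then show ?thesis by (simp add: push_def[abs_def] Int_assoc)
qed

text \<open>If \<open>r\<close> separates \<open>u\<close> from some hub of \<open>u\<close>, or is one itself, then pushing \<open>r\<close> replaces that hub.
  Otherwise all hubs of \<open>u\<close> lie in one component, and two such hub sets always meet.\<close>

lemma ex_root:
  assumes S: "convex S" "S \<noteq> {}" and H: "labeling S H"
  shows "\<exists>r\<in>S. \<forall>u\<in>S. card (push S r H u) \<le> card (H u)"
proof -
  have SV: "S \<subseteq> V" using S by (auto simp: convex_def)
  have fin: "finite (H u)" if "u \<in> S" for u
    using H that finite_subset[OF _ convex_finite[OF S(1)]] by (simp add: labeling_def)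
  have "\<exists>r\<in>S. \<forall>u\<in>S. u \<noteq> r \<longrightarrow> \<not> (\<exists>v\<in>S. H v \<subseteq> comp S r u)"
  proof (rule ex_vertex_avoiding[OF S])
    fix A B assume "\<exists>v\<in>S. H v \<subseteq> A" "\<exists>v\<in>S. H v \<subseteq> B"
    then obtain v w where "v \<in> S" "w \<in> S" "H v \<subseteq> A" "H w \<subseteq> B" by blast
    moreover from this have "H v \<inter> H w \<inter> P v w \<noteq> {}" using H by (simp add: labeling_def)
    ultimately show "A \<inter> B \<noteq> {}" by blast
  qed
  then obtain r where r: "r \<in> S" "\<And>u v. u \<in> S \<Longrightarrow> v \<in> S \<Longrightarrow> u \<noteq> r \<Longrightarrow> \<not> H v \<subseteq> comp S r u" by blast
  have "card (push S r H u) \<le> card (H u)" if u: "u \<in> S" for u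
  proof -
    have "\<exists>x. x \<in> H u \<and> x \<notin> comp S r u"
    proof (cases "u = r")
      case True
      then show ?thesis using labeling_self[OF SV H u] comp_root[OF SV r(1)] by blast
    next
      case False
      then show ?thesis using r(2)[of u u] u by blast
    qed
    then obtain x where x: "x \<in> H u" "x \<notin> comp S r u" by blast
    have "card (push S r H u) \<le> Suc (card (H u \<inter> comp S r u))"
      unfolding push_def by (rule card_insert_le_m1) auto
    also have "\<dots> = card (insert x (H u \<inter> comp S r u))" using x fin[OF u] by simp
    also have "\<dots> \<le> card (H u)" using x fin[OF u] by (intro card_mono) auto
    finally show ?thesis .
  qed
  then show ?thesis using r(1) by blast
qed

section \<open>Optimal roots and gluing\<close>

text \<open>Some optimal labeling has the shape "\<open>r\<close> everywhere, all other hubs inside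
  the own component". Optimality is asked of the pushed labeling, while \<open>H\<close> is any
  labeling.\<close>

definition opt_root :: "'a set \<Rightarrow> 'a \<Rightarrow> bool" where
  "opt_root S r \<longleftrightarrow> r \<in> S \<and> (\<exists>H. labeling S H \<and> optimal S (push S r H))"

lemma ex_opt_root:
  assumes "convex S" "S \<noteq> {}"
  shows "\<exists>r. opt_root S r"
proof -
  obtain H where H: "optimal S H" using ex_optimal[OF assms(1)] by blast
  then obtain r where r: "r \<in> S" "\<forall>u\<in>S. card (push S r H u) \<le> card (H u)"
    using ex_root[OF assms] unfolding optimal_def by blast
  then have "cost S (push S r H) \<le> cost S H" unfolding HL1_cost_def by (auto intro: sum_mono)
  moreover have "labeling S (push S r H)" using labeling_push H r assms unfolding optimal_def by blast
  ultimately have "optimal S (push S r H)" using H unfolding optimal_def by (meson order_trans)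
  then show ?thesis using H r unfolding opt_root_def optimal_def by blast
qed

lemma cost_mono_comps:
  assumes S: "convex S"
    and le: "\<And>u. u \<in> S - {r} \<Longrightarrow> cost (comp S r u) F \<le> cost (comp S r u) G"
  shows "cost (S - {r}) F \<le> cost (S - {r}) G"
proof -
  have SV: "S \<subseteq> V" using S by (auto simp: convex_def)
  have fin: "finite S" using convex_finite[OF S] .
  have cost: "cost (S - {r}) K = (\<Sum>C\<in>comp S r ` (S - {r}). cost C K)" for K
  proof -
    have "{x \<in> S - {r}. comp S r x = comp S r u} = comp S r u" if "u \<in> S - {r}" for u
      using that comp_eq[OF SV] comp_self[OF SV] root_notin_comp[OF SV, of u r] comp_subset[of S r u]
      by blast
    then have "(\<Sum>C\<in>comp S r ` (S - {r}). cost C K)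
        = (\<Sum>C\<in>comp S r ` (S - {r}). \<Sum>x\<in>{x \<in> S - {r}. comp S r x = C}. card (K x))"
      unfolding HL1_cost_def by (intro sum.cong) auto
    also have "\<dots> = cost (S - {r}) K"
      using sum.image_gen[of "S - {r}" "\<lambda>x. card (K x)" "comp S r"] fin
      by (simp add: HL1_cost_def)
    finally show ?thesis ..
  qed
  show ?thesis unfolding cost using le by (intro sum_mono) auto
qed

text \<open>A labeling of this shape costs \<open>card S\<close> for the root plus the costs on the
  components. On each component \<open>G\<close> is at most as costly as the restriction of the
  \<open>H\<close> that witnesses \<open>opt_root\<close>, since that restriction is itself a
  labeling.\<close>

lemma optimal_insert:
  assumes S: "convex S" and r: "opt_root S r"
    and G: "\<And>u. u \<in> S - {r} \<Longrightarrow> optimal (comp S r u) G"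
  shows "optimal S (\<lambda>v. insert r (G v \<inter> comp S r v))"
proof -
  have SV: "S \<subseteq> V" and rS: "r \<in> S" and fin: "finite S"
    using S r convex_finite by (auto simp: convex_def opt_root_def)
  obtain H where H: "labeling S H" "optimal S (push S r H)" using r by (auto simp: opt_root_def)
  have split: "cost S (\<lambda>v. insert r (K v \<inter> comp S r v))
      = card S + cost (S - {r}) (\<lambda>v. K v \<inter> comp S r v)" for K
  proof -
    have "cost S (\<lambda>v. insert r (K v \<inter> comp S r v)) = (\<Sum>v\<in>S. Suc (card (K v \<inter> comp S r v)))"
      unfolding HL1_cost_def
    proof (rule sum.cong[OF refl])
      fix v assume "v \<in> S"
      then have "r \<notin> comp S r v" "finite (comp S r v)"
        using root_notin_comp[OF SV] finite_subset[OF comp_subset fin] by simp_all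
      then show "card (insert r (K v \<inter> comp S r v)) = Suc (card (K v \<inter> comp S r v))" by simp
    qed
    also have "\<dots> = card S + (\<Sum>v\<in>S. card (K v \<inter> comp S r v))"
      using sum.distrib[of "\<lambda>_. 1" "\<lambda>v. card (K v \<inter> comp S r v)" S] by simp
    also have "(\<Sum>v\<in>S. card (K v \<inter> comp S r v)) = cost (S - {r}) (\<lambda>v. K v \<inter> comp S r v)"
      unfolding HL1_cost_def using rS fin comp_root[OF SV rS]
      by (subst sum.remove[of S r]) auto
    finally show ?thesis .
  qed
  have "cost (S - {r}) (\<lambda>v. G v \<inter> comp S r v) \<le> cost (S - {r}) (\<lambda>v. H v \<inter> comp S r v)"
  proof (rule cost_mono_comps[OF S])
    fix u assume u: "u \<in> S - {r}"
    then have "labeling (comp S r u) (\<lambda>v. H v \<inter> comp S r v)" using labeling_comp[OF S H(1)] by blast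
    then have "cost (comp S r u) G \<le> cost (comp S r u) (\<lambda>v. H v \<inter> comp S r v)"
      using G[OF u] by (auto simp: optimal_def)
    moreover have "cost (comp S r u) (\<lambda>v. G v \<inter> comp S r v) = cost (comp S r u) G"
    proof (rule cost_cong)
      fix v assume v: "v \<in> comp S r u"
      then have "G v \<subseteq> comp S r u" "comp S r v = comp S r u"
        using G[OF u] comp_eq[OF SV _ v] u by (simp_all add: optimal_def labeling_def)
      then show "G v \<inter> comp S r v = G v" by blast
    qed
    ultimately show "cost (comp S r u) (\<lambda>v. G v \<inter> comp S r v)
        \<le> cost (comp S r u) (\<lambda>v. H v \<inter> comp S r v)" by simp
  qed
  then have "cost S (\<lambda>v. insert r (G v \<inter> comp S r v)) \<le> cost S (push S r H)"
    unfolding push_def[abs_def] split by simp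
  moreover have "labeling S (\<lambda>v. insert r (G v \<inter> comp S r v))"
    using labeling_insert[OF S rS] G unfolding optimal_def by blast
  ultimately show ?thesis using H(2) unfolding optimal_def by (meson order_trans)
qed

text \<open>The optimal labeling of one component may be prescribed: the others are filled with
  arbitrary optimal labelings and everything is glued along \<open>r\<close>. This is how common
  hubs are carried outwards along a descent.\<close>

lemma optimal_extend:
  assumes S: "convex S" and r: "opt_root S r" and u: "u \<in> S - {r}" and G: "optimal (comp S r u) G"
  shows "\<exists>H. optimal S H \<and> (\<forall>v\<in>comp S r u. H v = insert r (G v))"
proof -
  have SV: "S \<subseteq> V" using S by (auto simp: convex_def)
  \<comment> \<open>The choice depends on the component as a set, so all vertices of a component
    read their hubs from the same labeling.\<close>
  define F where "F C = (if C = comp S r u then G else SOME H. optimal C H)" for C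
  have F: "optimal (comp S r v) (F (comp S r v))" if "v \<in> S" for v
    using G someI_ex[OF ex_optimal[OF convex_comp[OF S that]]] by (simp add: F_def)
  define K where "K v = F (comp S r v) v" for v
  have "optimal (comp S r v) K" if "v \<in> S" for v
    using F[OF that] comp_eq[OF SV that] optimal_cong[of "comp S r v" K "F (comp S r v)"]
    by (simp add: K_def)
  then have "optimal S (\<lambda>v. insert r (K v \<inter> comp S r v))"
    using optimal_insert[OF S r] by blast
  moreover have "insert r (K v \<inter> comp S r v) = insert r (G v)" if v: "v \<in> comp S r u" for v
  proof -
    have "comp S r v = comp S r u" using comp_eq[OF SV _ v] u by simp
    moreover have "G v \<subseteq> comp S r u" using G v by (simp add: optimal_def labeling_def)
    ultimately show ?thesis by (auto simp: K_def F_def)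
  qed
  ultimately show ?thesis by blast
qed

text \<open>\<open>descent k S Q C\<close>: removing \<open>k\<close> optimal roots in succession, which form the set \<open>Q\<close>, leads from
  \<open>S\<close> to \<open>C\<close>.\<close>

inductive descent :: "nat \<Rightarrow> 'a set \<Rightarrow> 'a set \<Rightarrow> 'a set \<Rightarrow> bool" where
  descent_0: "descent 0 S {} S"
| descent_Suc: "opt_root S r \<Longrightarrow> u \<in> S - {r} \<Longrightarrow> descent k (comp S r u) Q C
    \<Longrightarrow> descent (Suc k) S (insert r Q) C"

text \<open>Each root lies outside the component entered next, so the roots are pairwise distinct.
  \<open>optimal_extend\<close> adds the outer root to all hub sets of that component and keeps the
  hubs found further inside.\<close>

lemma descent_props:
  "descent k S Q C \<Longrightarrow> convex S \<Longrightarrow> S \<noteq> {} \<Longrightarrow>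
    card Q = k \<and> Q \<subseteq> S \<and> convex C \<and> C \<subseteq> S \<and> C \<noteq> {} \<and>
    (\<exists>H. optimal S H \<and> (\<forall>v\<in>C. Q \<subseteq> H v))"
proof (induction rule: descent.induct)
  case (descent_0 S)
  then show ?case using ex_optimal by auto
next
  case (descent_Suc S r u k Q C)
  have SV: "S \<subseteq> V" using descent_Suc.prems by (auto simp: convex_def)
  have u: "u \<in> comp S r u" using comp_self SV descent_Suc.hyps by auto
  have conv: "convex (comp S r u)" using convex_comp descent_Suc by blast
  have IH: "card Q = k" "Q \<subseteq> comp S r u" "convex C" "C \<subseteq> comp S r u" "C \<noteq> {}"
    using descent_Suc.IH conv u by auto
  obtain G where G: "optimal (comp S r u) G" "\<forall>v\<in>C. Q \<subseteq> G v"
    using descent_Suc.IH conv u by blast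
  then obtain H where H: "optimal S H" "\<forall>v\<in>comp S r u. H v = insert r (G v)"
    using optimal_extend descent_Suc by meson
  then have "\<forall>v\<in>C. insert r Q \<subseteq> H v" using G IH by blast
  moreover have "card (insert r Q) = Suc k"
    using root_notin_comp[OF SV, of u r] IH descent_Suc.hyps convex_finite[OF conv] finite_subset
    by (metis Diff_iff card_insert_disjoint subset_iff)
  ultimately show ?case
    using IH H(1) comp_subset[of S r u] descent_Suc.hyps(1) unfolding opt_root_def by blast
qed

text \<open>Pushing a centroid \<open>c\<close> costs at most one hub per vertex. It saves every common hub \<open>q \<in> Q\<close> at
  all vertices of \<open>C\<close> outside the component of \<open>q\<close>, hence at no fewer than \<open>card C - card S / 2\<close>.\<close>

lemma common_hubs_bound:
  assumes S: "convex S" "S \<noteq> {}" and H: "optimal S H" and C: "C \<subseteq> S" and Q: "Q \<subseteq> S"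
    and common: "\<And>v. v \<in> C \<Longrightarrow> Q \<subseteq> H v"
  shows "2 * card Q * card C \<le> (card Q + 2) * card S"
proof -
  have SV: "S \<subseteq> V" and fin: "finite S" using S convex_finite by (auto simp: convex_def)
  have lab: "labeling S H" using H by (simp add: optimal_def)
  have finH: "finite (H v)" if "v \<in> S" for v
    using lab that finite_subset[OF _ fin] by (simp add: labeling_def)
  have finC: "finite C" and finQ: "finite Q" using finite_subset[OF _ fin] C Q by auto
  obtain c where c: "c \<in> S" "\<And>u. u \<in> S \<Longrightarrow> 2 * card (comp S c u) \<le> card S"
    using ex_centroid[OF S] by blast
  have pushle: "card (push S c H v) + card (if v \<in> C then Q - comp S c v else {}) \<le> 1 + card (H v)"
    if v: "v \<in> S" for v
  proof -
    have "card (push S c H v) \<le> Suc (card (H v \<inter> comp S c v))"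
      unfolding push_def by (rule card_insert_le_m1) auto
    \<comment> \<open>The hubs kept by the push and the common hubs outside the component of
      \<open>v\<close> are disjoint parts of \<open>H v\<close>.\<close>
    moreover have "card (H v \<inter> comp S c v) + card (if v \<in> C then Q - comp S c v else {})
        = card ((H v \<inter> comp S c v) \<union> (if v \<in> C then Q - comp S c v else {}))"
      using finH[OF v] finQ by (intro card_Un_disjoint[symmetric]) auto
    moreover have "\<dots> \<le> card (H v)"
      using finH[OF v] common by (intro card_mono) auto
    ultimately show ?thesis by linarith
  qed
  have "cost S (push S c H) + (\<Sum>v\<in>C. card (Q - comp S c v)) \<le> card S + cost S H"
  proof -
    have "(\<Sum>v\<in>C. card (Q - comp S c v)) = (\<Sum>v\<in>S. card (if v \<in> C then Q - comp S c v else {}))"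
      using C fin by (intro sum.mono_neutral_cong_left) auto
    then have "cost S (push S c H) + (\<Sum>v\<in>C. card (Q - comp S c v))
        = (\<Sum>v\<in>S. card (push S c H v) + card (if v \<in> C then Q - comp S c v else {}))"
      by (simp add: HL1_cost_def sum.distrib)
    also have "\<dots> \<le> (\<Sum>v\<in>S. 1 + card (H v))" using pushle by (rule sum_mono)
    also have "\<dots> = card S + cost S H" by (simp only: HL1_cost_def sum.distrib) simp
    finally show ?thesis .
  qed
  moreover have "cost S H \<le> cost S (push S c H)"
    using H labeling_push[OF S(1) lab c(1)] by (simp add: optimal_def)
  ultimately have gain: "(\<Sum>v\<in>C. card (Q - comp S c v)) \<le> card S" by linarith
  have "(\<Sum>v\<in>C. card (Q - comp S c v)) = (\<Sum>v\<in>C. \<Sum>q\<in>Q. if q \<notin> comp S c v then 1 else 0)"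
    using finQ by (intro sum.cong refl) (simp add: sum.If_cases set_diff_eq Int_def)
  also have "\<dots> = (\<Sum>q\<in>Q. \<Sum>v\<in>C. if q \<notin> comp S c v then 1 else 0)"
    by (rule sum.swap)
  also have "\<dots> = (\<Sum>q\<in>Q. card {v \<in> C. q \<notin> comp S c v})"
    using finC by (intro sum.cong refl) (simp add: sum.If_cases Int_def)
  finally have swap: "(\<Sum>v\<in>C. card (Q - comp S c v)) = (\<Sum>q\<in>Q. card {v \<in> C. q \<notin> comp S c v})" .
  \<comment> \<open>By symmetry of paths, \<open>q\<close> survives exactly at the vertices of its
    own component, which is at most half of \<open>S\<close> because \<open>c\<close> is a
    centroid.\<close>
  have "2 * card C \<le> card S + 2 * card {v \<in> C. q \<notin> comp S c v}" if q: "q \<in> Q" for q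
  proof -
    have "P v q = P q v" if "v \<in> C" for v
      using that C Q q SV by (intro P_sym) auto
    then have "C \<subseteq> comp S c q \<union> {v \<in> C. q \<notin> comp S c v}"
      using C Q q by (auto simp: comp_def)
    then have "card C \<le> card (comp S c q \<union> {v \<in> C. q \<notin> comp S c v})"
      using finC fin comp_subset[of S c q] finite_subset by (intro card_mono) auto
    also have "\<dots> \<le> card (comp S c q) + card {v \<in> C. q \<notin> comp S c v}" by (rule card_Un_le)
    finally show ?thesis using c(2)[of q] q Q by fastforce
  qed
  then have "(\<Sum>q\<in>Q. 2 * card C) \<le> (\<Sum>q\<in>Q. card S + 2 * card {v \<in> C. q \<notin> comp S c v})"
    by (rule sum_mono)
  also have "\<dots> = card Q * card S + 2 * (\<Sum>v\<in>C. card (Q - comp S c v))"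
    by (simp add: sum.distrib sum_distrib_left swap)
  finally show ?thesis using gain by (simp add: algebra_simps)
qed

text \<open>Four common hubs turn the bound into 8 |C| \<le> 6 |S|. Three would give the ratio 5/6,
  and two no decrease at all.\<close>

lemma descent_shrink:
  assumes "descent 4 S Q C" "convex S" "S \<noteq> {}"
  shows "4 * card C \<le> 3 * card S"
proof -
  obtain H where "card Q = 4" "Q \<subseteq> S" "C \<subseteq> S" "optimal S H" "\<forall>v\<in>C. Q \<subseteq> H v"
    using descent_props[OF assms] by blast
  then show ?thesis using common_hubs_bound[OF assms(2,3), of H C Q] by auto
qed

end

section \<open>The recursive algorithm\<close>

text \<open>All blocks that meet the edge are collected in \<open>acc\<close> and emitted as one
  block at the end, unless there are none. An edge with an end outside the blocks, such as the
  removed root, joins nothing and at most moves one block, so the full edge list serves at every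
  level.\<close>

fun merge_blocks :: "'a \<Rightarrow> 'a \<Rightarrow> 'a list list \<Rightarrow> 'a list \<Rightarrow> 'a list list" where
  "merge_blocks a b [] acc = (if acc = [] then [] else [acc])"
| "merge_blocks a b (B # Bs) acc =
    (if a \<in> set B \<or> b \<in> set B then merge_blocks a b Bs (B @ acc) else B # merge_blocks a b Bs acc)"

fun blocks :: "('a \<times> 'a) list \<Rightarrow> 'a list list \<Rightarrow> 'a list list" where
  "blocks [] Bs = Bs"
| "blocks ((a, b) # es) Bs = blocks es (merge_blocks a b Bs [])"

definition singles :: "'a \<Rightarrow> 'a list \<Rightarrow> 'a list list" where
  "singles r vs = map (\<lambda>v. [v]) (filter (\<lambda>v. v \<noteq> r) vs)"

definition add_root :: "'a \<Rightarrow> ('a \<times> 'a list) list \<Rightarrow> ('a \<times> 'a list) list" where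
  "add_root r = map (\<lambda>(u, h). (u, r # h))"

definition total_length :: "('a \<times> 'a list) list \<Rightarrow> nat" where
  "total_length lab = sum_list (map (\<lambda>(u, h). length h) lab)"

definition trivial_labels :: "'a list \<Rightarrow> ('a \<times> 'a list) list" where
  "trivial_labels vs = map (\<lambda>u. (u, vs)) vs"

text \<open>The recursive call is abstracted to \<open>f\<close>, so that one level can be verified
  for any solver of the blocks.\<close>

definition candidate ::
  "('a \<times> 'a) list \<Rightarrow> ('a list \<Rightarrow> ('a \<times> 'a list) list) \<Rightarrow> 'a list \<Rightarrow> 'a \<Rightarrow> ('a \<times> 'a list) list" where
  "candidate es f vs r = (r, [r]) # concat (map (\<lambda>B. add_root r (f B)) (blocks es (singles r vs)))"

definition cheaper ::
  "('a \<times> 'a list) list \<Rightarrow> ('a \<times> 'a list) list \<Rightarrow> ('a \<times> 'a list) list" where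
  "cheaper best c = (if total_length c \<le> total_length best then c else best)"

text \<open>Out of fuel, every vertex takes all of \<open>vs\<close> as hubs: expensive but valid,
  so a truncated branch cannot produce a total below the optimum.\<close>

primrec solve :: "('a \<times> 'a) list \<Rightarrow> nat \<Rightarrow> 'a list \<Rightarrow> ('a \<times> 'a list) list" where
  "solve es 0 = trivial_labels"
| "solve es (Suc d) = (\<lambda>vs.
    foldl (\<lambda>best r. cheaper best (candidate es (solve es d) vs r)) (trivial_labels vs) vs)"

definition label_of :: "('a \<times> 'a list) list \<Rightarrow> 'a \<Rightarrow> 'a set" where
  "label_of lab u = set (the (map_of lab u))"

definition same_block :: "'a list list \<Rightarrow> 'a \<Rightarrow> 'a \<Rightarrow> bool" where
  "same_block Bs u v \<longleftrightarrow> (\<exists>B\<in>set Bs. u \<in> set B \<and> v \<in> set B)"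

text \<open>Multisets carry both later needs: distinctness of the concatenation, hence disjointness
  of blocks, and its length, which enters the running time.\<close>

lemma mset_merge_blocks: "mset (concat (merge_blocks a b Bs acc)) = mset (concat Bs) + mset acc"
  by (induction a b Bs acc rule: merge_blocks.induct) (auto simp: ac_simps)

lemma set_merge_blocks: "set (concat (merge_blocks a b Bs acc)) = set (concat Bs) \<union> set acc"
  using mset_eq_setD[of "concat (merge_blocks a b Bs acc)" "concat Bs @ acc"]
  by (simp only: mset_merge_blocks mset_append set_append)

lemma Nil_notin_merge_blocks: "[] \<notin> set Bs \<Longrightarrow> [] \<notin> set (merge_blocks a b Bs acc)"
  by (induction a b Bs acc rule: merge_blocks.induct) (auto split: if_splits)

lemma in_merge_blocks:
  "B \<in> set (merge_blocks a b Bs acc) \<Longrightarrow>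
    B \<in> set Bs \<or> set B = set acc \<union> (\<Union>C\<in>{C \<in> set Bs. a \<in> set C \<or> b \<in> set C}. set C)"
proof (induction a b Bs acc rule: merge_blocks.induct)
  case (1 a b acc)
  then show ?case by (auto split: if_splits)
next
  case (2 a b B0 Bs acc)
  then show ?case by (cases "a \<in> set B0 \<or> b \<in> set B0") fastforce+
qed

lemma merged_block_in_merge_blocks:
  assumes "acc \<noteq> [] \<or> (\<exists>C\<in>set Bs. C \<noteq> [] \<and> (a \<in> set C \<or> b \<in> set C))"
  shows "\<exists>B\<in>set (merge_blocks a b Bs acc).
    set B = set acc \<union> (\<Union>C\<in>{C \<in> set Bs. a \<in> set C \<or> b \<in> set C}. set C)"
  using assms
proof (induction a b Bs acc rule: merge_blocks.induct)
  case (1 a b acc)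
  then show ?case by auto
next
  case (2 a b B0 Bs acc)
  show ?case
  proof (cases "a \<in> set B0 \<or> b \<in> set B0")
    case True
    then have "B0 @ acc \<noteq> []" by auto
    then obtain B where "B \<in> set (merge_blocks a b Bs (B0 @ acc))"
      "set B = set (B0 @ acc) \<union> (\<Union>C\<in>{C \<in> set Bs. a \<in> set C \<or> b \<in> set C}. set C)"
      using 2(1) True by blast
    then show ?thesis using True by (intro bexI[of _ B]) auto
  next
    case False
    then obtain B where "B \<in> set (merge_blocks a b Bs acc)"
      "set B = set acc \<union> (\<Union>C\<in>{C \<in> set Bs. a \<in> set C \<or> b \<in> set C}. set C)"
      using 2(2) 2(3) by auto
    then show ?thesis using False by (intro bexI[of _ B]) auto
  qed
qed

lemma unmerged_block_in_merge_blocks: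
  "B \<in> set Bs \<Longrightarrow> a \<notin> set B \<Longrightarrow> b \<notin> set B \<Longrightarrow> B \<in> set (merge_blocks a b Bs acc)"
  by (induction a b Bs acc rule: merge_blocks.induct) auto

lemma same_block_merge:
  assumes "same_block Bs u v"
  shows "same_block (merge_blocks a b Bs []) u v"
proof -
  obtain B where B: "B \<in> set Bs" "u \<in> set B" "v \<in> set B" using assms by (auto simp: same_block_def)
  show ?thesis
  proof (cases "a \<in> set B \<or> b \<in> set B")
    case True
    then have "\<exists>C\<in>set Bs. C \<noteq> [] \<and> (a \<in> set C \<or> b \<in> set C)"
      using B by (intro bexI[of _ B]) auto
    then obtain B' where "B' \<in> set (merge_blocks a b Bs [])"
      "set B' = (\<Union>C\<in>{C \<in> set Bs. a \<in> set C \<or> b \<in> set C}. set C)"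
      using merged_block_in_merge_blocks[of "[]" Bs a b] by auto
    moreover have "set B \<subseteq> (\<Union>C\<in>{C \<in> set Bs. a \<in> set C \<or> b \<in> set C}. set C)"
      using True B(1) by auto
    ultimately show ?thesis using B(2,3) unfolding same_block_def by blast
  next
    case False
    then show ?thesis using B unmerged_block_in_merge_blocks unfolding same_block_def by metis
  qed
qed

lemma same_block_merge_edge:
  assumes "a \<in> set (concat Bs)" "b \<in> set (concat Bs)"
  shows "same_block (merge_blocks a b Bs []) a b"
proof -
  obtain A B where AB: "A \<in> set Bs" "a \<in> set A" "B \<in> set Bs" "b \<in> set B" using assms by auto
  then have "\<exists>C\<in>set Bs. C \<noteq> [] \<and> (a \<in> set C \<or> b \<in> set C)"
    by (intro bexI[of _ A]) auto
  then obtain B' where "B' \<in> set (merge_blocks a b Bs [])"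
    "set B' = (\<Union>C\<in>{C \<in> set Bs. a \<in> set C \<or> b \<in> set C}. set C)"
    using merged_block_in_merge_blocks[of "[]" Bs a b] by auto
  moreover have "a \<in> (\<Union>C\<in>{C \<in> set Bs. a \<in> set C \<or> b \<in> set C}. set C)"
    "b \<in> (\<Union>C\<in>{C \<in> set Bs. a \<in> set C \<or> b \<in> set C}. set C)" using AB by auto
  ultimately show ?thesis unfolding same_block_def by blast
qed

lemma same_block_blocks: "same_block Bs u v \<Longrightarrow> same_block (blocks es Bs) u v"
  by (induction es Bs rule: blocks.induct) (auto intro: same_block_merge)

lemma mset_blocks: "mset (concat (blocks es Bs)) = mset (concat Bs)"
  by (induction es Bs rule: blocks.induct) (simp_all add: mset_merge_blocks)

lemma set_concat_blocks: "set (concat (blocks es Bs)) = set (concat Bs)"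
  by (rule mset_eq_setD[OF mset_blocks])

lemma Nil_notin_blocks: "[] \<notin> set Bs \<Longrightarrow> [] \<notin> set (blocks es Bs)"
  by (induction es Bs rule: blocks.induct) (simp_all add: Nil_notin_merge_blocks)

lemma same_block_blocks_edge:
  "(a, b) \<in> set es \<Longrightarrow> a \<in> set (concat Bs) \<Longrightarrow> b \<in> set (concat Bs) \<Longrightarrow> same_block (blocks es Bs) a b"
proof (induction es Bs rule: blocks.induct)
  case (1 Bs)
  then show ?case by simp
next
  case (2 x y es Bs)
  have *: "set (concat (merge_blocks x y Bs [])) = set (concat Bs)"
    by (simp only: set_merge_blocks) simp
  show ?case
  proof (cases "(a, b) = (x, y)")
    case True
    then show ?thesis using same_block_blocks same_block_merge_edge 2 by fastforce
  next
    case False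
    then show ?thesis using 2 * by auto
  qed
qed

lemma concat_singles: "concat (singles r vs) = filter (\<lambda>v. v \<noteq> r) vs"
  by (induction vs) (auto simp: singles_def)

lemma mset_concat_blocks_singles:
  "mset (concat (blocks es (singles r vs))) = mset (filter (\<lambda>v. v \<noteq> r) vs)"
  by (simp add: mset_blocks concat_singles)

lemma set_concat_blocks_singles: "set (concat (blocks es (singles r vs))) = set vs - {r}"
  by (auto simp only: set_concat_blocks concat_singles set_filter)

lemma distinct_concat_blocks_singles:
  "distinct vs \<Longrightarrow> distinct (concat (blocks es (singles r vs)))"
  using mset_eq_imp_distinct_iff[OF mset_concat_blocks_singles[of es r vs]] distinct_filter by blast

lemma distinct_block: "distinct (concat Bs) \<Longrightarrow> B \<in> set Bs \<Longrightarrow> distinct B"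
  by (auto simp: distinct_concat_iff)

lemma same_block_unique:
  assumes "distinct (concat Bs)" "A \<in> set Bs" "B \<in> set Bs" "u \<in> set A" "u \<in> set B"
  shows "A = B"
  using assms unfolding distinct_concat_iff by (metis disjoint_iff)

lemma foldl_cheaper:
  fixes g :: "'b \<Rightarrow> ('a \<times> 'a list) list"
  defines "F \<equiv> foldl (\<lambda>best r. cheaper best (g r))"
  shows "F b rs \<in> insert b (g ` set rs) \<and>
    (\<forall>x\<in>insert b (g ` set rs). total_length (F b rs) \<le> total_length x)"
proof (induction rs arbitrary: b)
  case Nil
  then show ?case by (simp add: F_def)
next
  case (Cons r rs)
  show ?case using Cons[of "cheaper b (g r)"] by (auto simp: F_def cheaper_def split: if_splits)
qed

section \<open>Blocks are components\<close>

text \<open>The link between the edge list and the path sets: an edge is a path with two vertices,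
  and every path is traversed along listed edges in either orientation.\<close>

locale tree_edges = path_system V P for V :: "'a set" and P +
  fixes es :: "('a \<times> 'a) list"
  assumes edge_path: "(a, b) \<in> set es \<Longrightarrow> P a b = {a, b}"
    and edge_in: "(a, b) \<in> set es \<Longrightarrow> a \<in> V \<and> b \<in> V"
    and path_edges: "u \<in> V \<Longrightarrow> v \<in> V \<Longrightarrow>
      \<exists>p. p \<noteq> [] \<and> hd p = u \<and> set p = P u v \<and>
        successively (\<lambda>a b. (a, b) \<in> set es \<or> (b, a) \<in> set es) p"
begin

text \<open>Vertices of one block stay joined by paths inside \<open>X\<close>: a merge adds only
  pairs whose path is covered by an old path to an end of the edge, the edge itself if the ends
  differ, and an old path onwards.\<close>

lemma blocks_linked:
  assumes "set es' \<subseteq> set es" "X \<subseteq> V" "set (concat Bs) = X"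
    and "\<And>u v. same_block Bs u v \<Longrightarrow> P u v \<subseteq> X"
  shows "same_block (blocks es' Bs) u v \<Longrightarrow> P u v \<subseteq> X"
  using assms
proof (induction es' Bs rule: blocks.induct)
  case (1 Bs)
  then show ?case by simp
next
  case (2 a b es' Bs)
  note in_X = 2(4) and X = 2(5) and old = 2(6)
  have ab: "a \<in> V" "b \<in> V" "P a b = {a, b}" "P b a = {a, b}"
    using edge_in[of a b] edge_path[of a b] P_sym[of a b] 2 by auto
  have "P u v \<subseteq> X" if uv: "same_block (merge_blocks a b Bs []) u v" for u v
  proof (cases "same_block Bs u v")
    case True
    then show ?thesis using old by blast
  next
    case False
    from uv obtain B where B: "B \<in> set (merge_blocks a b Bs [])" "u \<in> set B" "v \<in> set B"
      by (auto simp: same_block_def)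
    with False have "B \<notin> set Bs" by (auto simp: same_block_def)
    then have "set B = (\<Union>C\<in>{C \<in> set Bs. a \<in> set C \<or> b \<in> set C}. set C)"
      using in_merge_blocks[OF B(1)] by auto
    with B obtain C D where C: "C \<in> set Bs" "u \<in> set C" "a \<in> set C \<or> b \<in> set C"
      and D: "D \<in> set Bs" "v \<in> set D" "a \<in> set D \<or> b \<in> set D"
      by auto
    have uvX: "u \<in> X" "v \<in> X" using C D X by auto
    obtain x y where x: "x \<in> {a, b}" "x \<in> set C" and y: "y \<in> {a, b}" "y \<in> set D" using C D by blast
    have xyX: "x \<in> X" "y \<in> X" using C D x y X by auto
    have "P x y \<subseteq> X"
    proof (cases "x = y")
      case True
      then show ?thesis using P_self xyX in_X by auto
    next
      case False
      then have "P x y = {a, b}" "{a, b} = {x, y}" using x(1) y(1) ab by auto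
      then show ?thesis using xyX by simp
    qed
    moreover have "same_block Bs u x" "same_block Bs y v"
      using C D x y unfolding same_block_def by blast+
    then have "P u x \<subseteq> X" "P y v \<subseteq> X" using old by blast+
    moreover have "P u v \<subseteq> P u x \<union> P x v" "P x v \<subseteq> P x y \<union> P y v"
      using P_trans uvX xyX in_X by auto
    ultimately show ?thesis by blast
  qed
  moreover have "set (concat (merge_blocks a b Bs [])) = X"
    unfolding set_merge_blocks using X by simp
  ultimately show ?case using 2 by auto
qed

text \<open>By \<open>blocks_linked\<close> with \<open>X = S - {r}\<close>, a block never crosses
  \<open>r\<close>. Conversely, a path in \<open>S - {r}\<close> cannot leave its block: the ends of
  each of its edges share a block, and blocks are disjoint.\<close>

lemma block_eq_comp:
  assumes S: "convex S" "set vs = S" and r: "r \<in> S"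
    and dist: "distinct vs" and B: "B \<in> set (blocks es (singles r vs))" and u: "u \<in> set B"
  shows "set B = comp S r u"
proof
  have SV: "S \<subseteq> V" using S by (auto simp: convex_def)
  have uS: "u \<in> S - {r}" using set_concat_blocks_singles[of es r vs] S B u by auto
  show "set B \<subseteq> comp S r u"
  proof
    fix v assume v: "v \<in> set B"
    have "same_block (blocks es (singles r vs)) u v" using B u v by (auto simp: same_block_def)
    moreover have "P x y \<subseteq> S - {r}" if "same_block (singles r vs) x y" for x y
    proof -
      have "x = y" "x \<in> S - {r}" using that S by (auto simp: same_block_def singles_def)
      then show ?thesis using P_self SV by auto
    qed
    moreover have "set (concat (singles r vs)) = S - {r}" using S concat_singles[of r vs] by auto
    ultimately have "P u v \<subseteq> S - {r}"
      using blocks_linked[of es "S - {r}" "singles r vs" u v] SV by auto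
    moreover have "v \<in> S" using set_concat_blocks_singles[of es r vs] S B v by auto
    ultimately show "v \<in> comp S r u" by (auto simp: comp_def)
  qed
  have stay: "set p \<subseteq> set B" if "p \<noteq> []" "hd p \<in> set B" "set p \<subseteq> S - {r}"
    "successively (\<lambda>a b. (a, b) \<in> set es \<or> (b, a) \<in> set es) p" for p
    using that
  proof (induction p rule: induct_list012)
    case (3 x y p)
    have X: "set (concat (singles r vs)) = S - {r}" using S concat_singles[of r vs] by auto
    have "same_block (blocks es (singles r vs)) x y \<or> same_block (blocks es (singles r vs)) y x"
      using same_block_blocks_edge[of x y es "singles r vs"]
        same_block_blocks_edge[of y x es "singles r vs"] 3(4,5,6) unfolding X by auto
    then obtain B' where B': "B' \<in> set (blocks es (singles r vs))" "x \<in> set B'" "y \<in> set B'"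
      by (auto simp: same_block_def)
    then have "B' = B"
      using same_block_unique[OF distinct_concat_blocks_singles[OF dist] B'(1) B] 3(4) by simp
    then show ?case using 3 B' by auto
  qed auto
  show "comp S r u \<subseteq> set B"
  proof
    fix w assume w: "w \<in> comp S r u"
    then have w': "w \<in> S" "r \<notin> P u w" by (auto simp: comp_def)
    then obtain p where p: "p \<noteq> []" "hd p = u" "set p = P u w"
      "successively (\<lambda>a b. (a, b) \<in> set es \<or> (b, a) \<in> set es) p"
      using path_edges[of u w] uS SV by blast
    have "P u w \<subseteq> S" using S(1) uS w' unfolding convex_def by blast
    then have "set p \<subseteq> set B" using stay[of p] p u w' by auto
    moreover have "w \<in> P u w" using P_end uS w' SV by blast
    ultimately show "w \<in> set B" using p by blast
  qed
qed

section \<open>Association lists as labelings\<close>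

text \<open>With the keys a permutation of the vertex list and the hub lists free of repetitions,
  \<open>total_length\<close>, which the program compares, is the cost.\<close>

definition valid :: "'a list \<Rightarrow> ('a \<times> 'a list) list \<Rightarrow> bool" where
  "valid vs lab \<longleftrightarrow> mset (map fst lab) = mset vs \<and> (\<forall>(u, h)\<in>set lab. distinct h) \<and>
    labeling (set vs) (label_of lab)"

lemma valid_fst:
  assumes "valid vs lab" "distinct vs"
  shows "distinct (map fst lab)" "fst ` set lab = set vs" "length lab = length vs"
  using assms mset_eq_imp_distinct_iff[of "map fst lab" vs] mset_eq_setD[of "map fst lab" vs]
    mset_eq_length[of "map fst lab" vs]
  by (auto simp: valid_def)

lemma label_of_eq: "distinct (map fst lab) \<Longrightarrow> (u, h) \<in> set lab \<Longrightarrow> label_of lab u = set h"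
  by (simp add: label_of_def)

lemma valid_hubs:
  assumes "valid vs lab" "distinct vs" "(u, h) \<in> set lab"
  shows "distinct h" "set h \<subseteq> set vs" "length h \<le> length vs"
proof -
  show "distinct h" using assms by (auto simp: valid_def)
  have "u \<in> set vs" using valid_fst(2)[OF assms(1,2)] assms(3) by force
  then show sub: "set h \<subseteq> set vs"
    using assms label_of_eq[OF valid_fst(1)[OF assms(1,2)] assms(3)]
    by (auto simp: valid_def labeling_def)
  show "length h \<le> length vs"
    using card_mono[OF _ sub] \<open>distinct h\<close> assms(2) by (simp add: distinct_card)
qed

lemma total_length_eq_cost:
  assumes "valid vs lab" "distinct vs"
  shows "total_length lab = cost (set vs) (label_of lab)"
proof -
  have inj: "inj_on fst (set lab)" "distinct lab"
    using valid_fst(1)[OF assms] by (auto simp: distinct_map)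
  have "total_length lab = (\<Sum>p\<in>set lab. length (snd p))"
    using inj by (simp add: total_length_def sum_list_distinct_conv_sum_set split_def)
  also have "\<dots> = (\<Sum>p\<in>set lab. card (label_of lab (fst p)))"
    using label_of_eq[OF valid_fst(1)[OF assms]] valid_hubs(1)[OF assms]
    by (intro sum.cong) (auto simp: distinct_card)
  also have "\<dots> = (\<Sum>u\<in>fst ` set lab. card (label_of lab u))"
    using inj by (simp add: sum.reindex)
  finally show ?thesis using valid_fst(2)[OF assms] by (simp add: HL1_cost_def)
qed

lemma valid_trivial_labels:
  assumes "convex (set vs)" "distinct vs"
  shows "valid vs (trivial_labels vs)"
proof -
  have "map fst (trivial_labels vs) = vs" by (simp add: trivial_labels_def comp_def o_def)
  moreover have "label_of (trivial_labels vs) u = set vs" if "u \<in> set vs" for u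
    using that assms calculation label_of_eq[of "trivial_labels vs" u vs]
    by (auto simp: trivial_labels_def)
  then have "labeling (set vs) (label_of (trivial_labels vs))"
    using labeling_all[OF assms(1)] labeling_cong[of "set vs" "label_of (trivial_labels vs)" "\<lambda>_. set vs"]
    by simp
  ultimately show ?thesis using assms(2) by (auto simp: valid_def trivial_labels_def)
qed

section \<open>Correctness of one candidate\<close>

context
  fixes vs r f
  assumes conv: "convex (set vs)" and dist: "distinct vs" and r: "r \<in> set vs"
    and f: "\<And>B. B \<in> set (blocks es (singles r vs)) \<Longrightarrow> valid B (f B)"
begin

private abbreviation "Bs \<equiv> blocks es (singles r vs)"
private abbreviation "c \<equiv> candidate es f vs r"

lemma mset_fst_candidate: "mset (map fst c) = mset vs"
proof -
  have "mset (map fst (concat (map (\<lambda>B. add_root r (f B)) Xs))) = mset (concat Xs)"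
    if "set Xs \<subseteq> set Bs" for Xs
    using that
  proof (induction Xs)
    case (Cons X Xs)
    have "map fst (add_root r (f X)) = map fst (f X)" by (simp add: add_root_def split_def)
    then show ?case using Cons f[of X] by (simp add: valid_def)
  qed simp
  then have "mset (map fst c) = add_mset r (mset (filter (\<lambda>v. v \<noteq> r) vs))"
    by (simp add: candidate_def mset_concat_blocks_singles del: mset_concat mset_filter mset_map)
  also have "\<dots> = mset vs"
  proof -
    have "distinct (r # filter (\<lambda>v. v \<noteq> r) vs)" "set (r # filter (\<lambda>v. v \<noteq> r) vs) = set vs"
      using dist r by auto
    then have "mset (r # filter (\<lambda>v. v \<noteq> r) vs) = mset vs"
      using dist set_eq_iff_mset_eq_distinct by blast
    then show ?thesis by simp
  qed
  finally show ?thesis .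
qed

lemma distinct_fst_candidate: "distinct (map fst c)"
  using mset_eq_imp_distinct_iff[OF mset_fst_candidate] dist by blast

lemma block_distinct: "B \<in> set Bs \<Longrightarrow> distinct B"
  using distinct_block distinct_concat_blocks_singles[OF dist] by blast

lemma label_of_candidate_block:
  assumes B: "B \<in> set Bs" "u \<in> set B"
  shows "label_of c u = insert r (label_of (f B) u)"
proof -
  have "u \<in> fst ` set (f B)" using valid_fst(2)[OF f[OF B(1)] block_distinct[OF B(1)]] B(2) by simp
  then obtain h where h: "(u, h) \<in> set (f B)" by force
  then have "(u, r # h) \<in> set c" using B by (force simp: candidate_def add_root_def)
  then show ?thesis
    using label_of_eq[OF distinct_fst_candidate] h
      label_of_eq[OF valid_fst(1)[OF f[OF B(1)] block_distinct[OF B(1)]] h] by force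
qed

lemma label_of_candidate_root: "label_of c r = {r}"
  by (simp add: candidate_def label_of_def)

lemma ex_block:
  assumes "u \<in> set vs - {r}"
  obtains B where "B \<in> set Bs" "u \<in> set B" "set B = comp (set vs) r u"
proof -
  have "u \<in> set (concat Bs)" using assms by (simp only: set_concat_blocks_singles)
  then show ?thesis using that block_eq_comp[OF conv refl r dist] by auto
qed

lemma label_of_candidate_restrict:
  assumes u: "u \<in> set vs - {r}"
  obtains B where "B \<in> set Bs" "set B = comp (set vs) r u"
    "\<And>v. v \<in> comp (set vs) r u \<Longrightarrow> label_of c v - {r} = label_of (f B) v"
proof -
  obtain B where B: "B \<in> set Bs" "u \<in> set B" "set B = comp (set vs) r u" using ex_block[OF u] .
  have "label_of c v - {r} = label_of (f B) v" if "v \<in> comp (set vs) r u" for v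
  proof -
    have v: "v \<in> set B" using that B by simp
    then have "label_of (f B) v \<subseteq> set B" using f[OF B(1)] by (simp add: valid_def labeling_def)
    moreover have "r \<notin> set B"
      using root_notin_comp[of "set vs" u r] conv u B by (auto simp: convex_def)
    ultimately show ?thesis using label_of_candidate_block[OF B(1) v] by blast
  qed
  then show ?thesis using that B by blast
qed

text \<open>Brings the candidate into the shape \<open>insert r (G v \<inter> comp S r v)\<close> of
  the gluing lemmas, with \<open>G v = label_of c v - {r}\<close>; on each component this
  \<open>G\<close> is the labeling returned for its block.\<close>

lemma label_of_candidate:
  assumes "v \<in> set vs"
  shows "label_of c v = insert r ((label_of c v - {r}) \<inter> comp (set vs) r v)"
proof (cases "v = r")
  case True
  then show ?thesis using label_of_candidate_root by simp
next
  case False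
  then have v: "v \<in> set vs - {r}" using assms by simp
  obtain B where B: "B \<in> set Bs" "v \<in> set B" "set B = comp (set vs) r v" using ex_block[OF v] .
  then have "label_of (f B) v \<subseteq> comp (set vs) r v"
    using f[OF B(1)] by (simp add: valid_def labeling_def)
  then show ?thesis using label_of_candidate_block[OF B(1,2)] by auto
qed

lemma valid_candidate: "valid vs c"
  unfolding valid_def
proof (intro conjI)
  show "mset (map fst c) = mset vs" using mset_fst_candidate .
  have "distinct (r # h)" if B: "B \<in> set Bs" and h: "(u, h) \<in> set (f B)" for B u h
  proof -
    have "r \<notin> set B" using set_concat_blocks_singles[of es r vs] B by auto
    then show ?thesis using valid_hubs[OF f[OF B] block_distinct[OF B] h] by auto
  qed
  then show "\<forall>(u, h)\<in>set c. distinct h" by (fastforce simp: candidate_def add_root_def)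
  have "labeling (set vs) (\<lambda>v. insert r ((label_of c v - {r}) \<inter> comp (set vs) r v))"
  proof (rule labeling_insert[OF conv r])
    fix u assume "u \<in> set vs" "u \<noteq> r"
    then obtain B where B: "B \<in> set Bs" "set B = comp (set vs) r u"
      "\<And>v. v \<in> comp (set vs) r u \<Longrightarrow> label_of c v - {r} = label_of (f B) v"
      using label_of_candidate_restrict[of u] by auto
    have "labeling (comp (set vs) r u) (label_of (f B))"
      using f[OF B(1)] B(2) by (simp add: valid_def)
    then show "labeling (comp (set vs) r u) (\<lambda>v. label_of c v - {r})"
      using labeling_cong[THEN iffD2, OF B(3)] by simp
  qed
  then show "labeling (set vs) (label_of c)"
    by (subst labeling_cong[OF label_of_candidate])
qed

lemma optimal_candidate:
  assumes "opt_root (set vs) r" and opt: "\<And>B. B \<in> set Bs \<Longrightarrow> optimal (set B) (label_of (f B))"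
  shows "optimal (set vs) (label_of c)"
proof -
  have "optimal (set vs) (\<lambda>v. insert r ((label_of c v - {r}) \<inter> comp (set vs) r v))"
  proof (rule optimal_insert[OF conv assms(1)])
    fix u assume "u \<in> set vs - {r}"
    then obtain B where B: "B \<in> set Bs" "set B = comp (set vs) r u"
      "\<And>v. v \<in> comp (set vs) r u \<Longrightarrow> label_of c v - {r} = label_of (f B) v"
      using label_of_candidate_restrict[of u] by auto
    have "optimal (comp (set vs) r u) (label_of (f B))"
      using opt[OF B(1)] B(2) by simp
    then show "optimal (comp (set vs) r u) (\<lambda>v. label_of c v - {r})"
      using optimal_cong[THEN iffD2, OF B(3)] by simp
  qed
  then show ?thesis by (subst optimal_cong[OF label_of_candidate])
qed

end

lemma block_convex:
  assumes "convex (set vs)" "distinct vs" "r \<in> set vs" "B \<in> set (blocks es (singles r vs))"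
  shows "convex (set B)" "distinct B" "B \<noteq> []"
proof -
  show "B \<noteq> []"
    using assms(4) Nil_notin_blocks[of "singles r vs" es] by (auto simp: singles_def)
  then obtain u where u: "u \<in> set B" by (cases B) auto
  moreover have "u \<in> set vs" using set_concat_blocks_singles[of es r vs] assms(4) u by auto
  ultimately show "convex (set B)"
    using block_eq_comp[OF assms(1) refl assms(3,2,4) u] convex_comp[OF assms(1), of u r] by simp
  show "distinct B" using distinct_block distinct_concat_blocks_singles assms by metis
qed

section \<open>Optimality with bounded recursion depth\<close>

lemma valid_solve:
  "convex (set vs) \<Longrightarrow> distinct vs \<Longrightarrow> valid vs (solve es d vs)"
proof (induction d arbitrary: vs)
  case 0
  then show ?case by (simp add: valid_trivial_labels)
next
  case (Suc d)
  have "valid vs (candidate es (solve es d) vs r)" if "r \<in> set vs" for r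
    using valid_candidate[OF Suc.prems that] Suc.IH block_convex[OF Suc.prems that] by blast
  moreover have "solve es (Suc d) vs \<in> insert (trivial_labels vs) (candidate es (solve es d) vs ` set vs)"
    using foldl_cheaper[of "candidate es (solve es d) vs" "trivial_labels vs" vs] by simp
  ultimately show ?case using valid_trivial_labels[OF Suc.prems] by auto
qed

text \<open>The minimum taken over all roots is at most the candidate of the optimal root
  \<open>r\<close>, which is optimal, and the result is itself a labeling, so it cannot cost
  less.\<close>

lemma optimal_solve_Suc:
  assumes S: "convex (set vs)" "distinct vs" and r: "opt_root (set vs) r"
    and opt: "\<And>B. B \<in> set (blocks es (singles r vs)) \<Longrightarrow> optimal (set B) (label_of (solve es d B))"
  shows "optimal (set vs) (label_of (solve es (Suc d) vs))"
proof -
  let ?c = "candidate es (solve es d) vs r"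
  have rS: "r \<in> set vs" using r by (simp add: opt_root_def)
  have B: "valid B (solve es d B)" if "B \<in> set (blocks es (singles r vs))" for B
    using valid_solve block_convex[OF S rS that] by blast
  have "total_length (solve es (Suc d) vs) \<le> total_length ?c"
    using foldl_cheaper[of "candidate es (solve es d) vs" "trivial_labels vs" vs] rS by simp
  moreover have "valid vs ?c" using valid_candidate[OF S rS B] .
  ultimately have "cost (set vs) (label_of (solve es (Suc d) vs)) \<le> cost (set vs) (label_of ?c)"
    using total_length_eq_cost valid_solve[OF S] S(2) by metis
  moreover have "optimal (set vs) (label_of ?c)" using optimal_candidate[OF S rS B r opt] .
  moreover have "labeling (set vs) (label_of (solve es (Suc d) vs))"
    using valid_solve[OF S] by (simp only: valid_def)
  ultimately show ?thesis unfolding optimal_def by (meson order_trans)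
qed

text \<open>At each level it suffices to follow one optimal root, so the remaining fuel
  \<open>d\<close> has to solve only the sets reached by \<open>k\<close> of them. Where the
  vertices are used up earlier there is no such descent, and the hypothesis is vacuous.\<close>

lemma optimal_solve_descent:
  assumes "convex (set vs)" "distinct vs" "vs \<noteq> []"
    and "\<And>Q ws. descent k (set vs) Q (set ws) \<Longrightarrow> distinct ws \<Longrightarrow>
      optimal (set ws) (label_of (solve es d ws))"
  shows "optimal (set vs) (label_of (solve es (k + d) vs))"
  using assms
proof (induction k arbitrary: vs)
  case 0
  then show ?case using 0(4)[OF descent_0] by simp
next
  case (Suc k)
  obtain r where r: "opt_root (set vs) r" using ex_opt_root Suc.prems by force
  then have rS: "r \<in> set vs" by (simp add: opt_root_def)
  have "optimal (set B) (label_of (solve es (k + d) B))"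
    if B: "B \<in> set (blocks es (singles r vs))" for B
  proof (rule Suc.IH)
    show "convex (set B)" "distinct B" "B \<noteq> []" using block_convex[OF Suc.prems(1,2) rS B] by blast+
    then obtain u where u: "u \<in> set B" by (cases B) auto
    then have "set B = comp (set vs) r u" "u \<in> set vs - {r}"
      using block_eq_comp[OF Suc.prems(1) refl rS Suc.prems(2) B]
        set_concat_blocks_singles[of es r vs] B by auto
    then show "optimal (set ws) (label_of (solve es d ws))"
      if "descent k (set B) Q (set ws)" "distinct ws" for Q ws
      using Suc.prems(4)[OF descent_Suc[OF r, of u]] that by simp
  qed
  then show ?case using optimal_solve_Suc[OF Suc.prems(1,2) r, of "k + d"] by simp
qed

text \<open>The hypothesis is |vs| (3/4)^m < 1 in integers. Four units of fuel pay for one factor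
  3/4; at \<open>m = 0\<close> it contradicts \<open>vs \<noteq> []\<close>.\<close>

lemma optimal_solve_fuel:
  "convex (set vs) \<Longrightarrow> distinct vs \<Longrightarrow> vs \<noteq> [] \<Longrightarrow> length vs * 3 ^ m < 4 ^ m \<Longrightarrow>
    optimal (set vs) (label_of (solve es (4 * m) vs))"
proof (induction m arbitrary: vs)
  case 0
  then show ?case by simp
next
  case (Suc m)
  have "optimal (set vs) (label_of (solve es (4 + 4 * m) vs))"
  proof (rule optimal_solve_descent[OF Suc.prems(1-3)])
    fix Q ws assume desc: "descent 4 (set vs) Q (set ws)" and ws: "distinct ws"
    have "4 * length ws \<le> 3 * length vs"
      using descent_shrink[OF desc Suc.prems(1)] Suc.prems ws by (simp add: distinct_card)
    then have "4 * (length ws * 3 ^ m) \<le> 3 * length vs * 3 ^ m"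
      using mult_right_mono[of "4 * length ws" "3 * length vs" "3 ^ m"] by (simp add: ac_simps)
    also have "\<dots> < 4 * 4 ^ m" using Suc.prems(4) by (simp add: ac_simps)
    finally have "length ws * 3 ^ m < 4 ^ m" by simp
    moreover have "convex (set ws)" "set ws \<noteq> {}"
      using descent_props[OF desc Suc.prems(1)] Suc.prems(3) by auto
    ultimately show "optimal (set ws) (label_of (solve es (4 * m) ws))"
      using Suc.IH ws by auto
  qed
  then show ?case by simp
qed

text \<open>Twelve units of fuel, three rounds of four roots, pay for each factor 2: 2 * 3^3 = 54 is
  below 4^3 = 64.\<close>

lemma optimal_solve_log:
  assumes "convex (set vs)" "distinct vs" "vs \<noteq> []" "length vs < 2 ^ L"
  shows "optimal (set vs) (label_of (solve es (12 * L) vs))"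
proof -
  have "length vs * 3 ^ (3 * L) < 2 ^ L * 3 ^ (3 * L)" using assms(4) by simp
  also have "\<dots> = (54::nat) ^ L" by (simp add: power_mult power_mult_distrib[symmetric])
  also have "\<dots> \<le> 64 ^ L" by (rule power_mono) auto
  also have "\<dots> = 4 ^ (3 * L)" by (simp add: power_mult)
  finally show ?thesis using optimal_solve_fuel[OF assms(1-3), of "3 * L"] by simp
qed

end

lemma tree_edges_tree_path:
  assumes T: "is_tree V E" and es: "represents_edges es E"
  shows "tree_edges V (tree_path V E) es"
proof (intro tree_edges.intro path_system_tree_path[OF T] tree_edges_axioms.intro)
  have E: "{a, b} \<in> E" if "(a, b) \<in> set es" for a b
    using es that by (force simp: represents_edges_def)
  show "tree_path V E a b = {a, b}" if "(a, b) \<in> set es" for a b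
    using tree_path_edge[OF T E[OF that]] .
  show "a \<in> V \<and> b \<in> V" if ab: "(a, b) \<in> set es" for a b
  proof -
    obtain u v where "u \<in> V" "v \<in> V" "{a, b} = {u, v}"
      using T E[OF ab] unfolding is_tree_def simple_graph_def by blast
    then show ?thesis by (auto simp: doubleton_eq_iff)
  qed
  show "\<exists>p. p \<noteq> [] \<and> hd p = u \<and> set p = tree_path V E u v \<and>
      successively (\<lambda>a b. (a, b) \<in> set es \<or> (b, a) \<in> set es) p" if "u \<in> V" "v \<in> V" for u v
  proof -
    obtain p where p: "simple_path V E u p v" "tree_path V E u v = set p"
      using ex_tree_path[OF T \<open>u \<in> V\<close> \<open>v \<in> V\<close>] by blast
    have "(a, b) \<in> set es \<or> (b, a) \<in> set es" if "{a, b} \<in> E" for a b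
      using es that by (force simp: represents_edges_def doubleton_eq_iff)
    then have "successively (\<lambda>a b. (a, b) \<in> set es \<or> (b, a) \<in> set es) p"
      using p(1) unfolding simple_path_def by (auto intro: successively_mono)
    then show ?thesis using p by (auto simp: simple_path_def)
  qed
qed

section \<open>Verifying programs\<close>

text \<open>Since evaluation is deterministic, the weakest precondition commutes with all constructors, so
  the simplifier can execute a function body symbolically up to its calls.\<close>

definition wp :: "program \<Rightarrow> val list \<Rightarrow> exp \<Rightarrow> (val \<Rightarrow> nat \<Rightarrow> bool) \<Rightarrow> bool" where
  "wp P env e Q \<longleftrightarrow> (\<exists>v t. evaluates P env e v t \<and> Q v t)"

definition wp_call :: "program \<Rightarrow> nat \<Rightarrow> val \<Rightarrow> (val \<Rightarrow> nat \<Rightarrow> bool) \<Rightarrow> bool" where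
  "wp_call P f w Q \<longleftrightarrow> f < length P \<and> wp P [w] (P ! f) Q"

lemma wp_simps:
  "wp P env (Var i) Q \<longleftrightarrow> i < length env \<and> Q (env ! i) 1"
  "wp P env (Const n) Q \<longleftrightarrow> Q (Atom n) 1"
  "wp P env (Op1 f e) Q \<longleftrightarrow> wp P env e (\<lambda>v t. Q (apply1 f v) (t + 1))"
  "wp P env (Op2 g e1 e2) Q \<longleftrightarrow>
    wp P env e1 (\<lambda>v1 t1. wp P env e2 (\<lambda>v2 t2. Q (apply2 g v1 v2) (t1 + t2 + 1)))"
  "wp P env (IfZero b e1 e2) Q \<longleftrightarrow>
    wp P env b (\<lambda>w t1. wp P env (if w = Atom 0 then e1 else e2) (\<lambda>v t2. Q v (t1 + t2 + 1)))"
  "wp P env (LetIn e1 e2) Q \<longleftrightarrow>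
    wp P env e1 (\<lambda>w t1. wp P (w # env) e2 (\<lambda>v t2. Q v (t1 + t2 + 1)))"
  "wp P env (Call k e) Q \<longleftrightarrow>
    wp P env e (\<lambda>w t1. wp_call P k w (\<lambda>v t2. Q v (t1 + t2 + 1)))"
proof -
  show "wp P env (Var i) Q \<longleftrightarrow> i < length env \<and> Q (env ! i) 1"
    by (auto simp: wp_def evaluates.simps[of _ _ "Var i"])
  show "wp P env (Const n) Q \<longleftrightarrow> Q (Atom n) 1"
    by (auto simp: wp_def evaluates.simps[of _ _ "Const n"])
  show "wp P env (Op1 f e) Q \<longleftrightarrow> wp P env e (\<lambda>v t. Q (apply1 f v) (t + 1))"
    by (auto simp: wp_def evaluates.simps[of _ _ "Op1 f e"])
  show "wp P env (Op2 g e1 e2) Q \<longleftrightarrow>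
      wp P env e1 (\<lambda>v1 t1. wp P env e2 (\<lambda>v2 t2. Q (apply2 g v1 v2) (t1 + t2 + 1)))"
    by (simp add: wp_def evaluates.simps[of _ _ "Op2 g e1 e2"]) blast
  show "wp P env (IfZero b e1 e2) Q \<longleftrightarrow>
      wp P env b (\<lambda>w t1. wp P env (if w = Atom 0 then e1 else e2) (\<lambda>v t2. Q v (t1 + t2 + 1)))"
    (is "?L \<longleftrightarrow> ?R")
  proof
    show "?L \<Longrightarrow> ?R"
      by (auto simp: wp_def evaluates.simps[of _ _ "IfZero b e1 e2"])
    show ?L if ?R
    proof -
      from that obtain w t1 v t2 where "evaluates P env b w t1"
        "evaluates P env (if w = Atom 0 then e1 else e2) v t2" "Q v (t1 + t2 + 1)"
        unfolding wp_def by blast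
      then show ?L
        using evaluates.IfZero_True[of P env b t1 e1 v t2 e2]
          evaluates.IfZero_False[of P env b w t1 e2 v t2 e1]
        unfolding wp_def by (cases "w = Atom 0") auto
    qed
  qed
  show "wp P env (LetIn e1 e2) Q \<longleftrightarrow>
      wp P env e1 (\<lambda>w t1. wp P (w # env) e2 (\<lambda>v t2. Q v (t1 + t2 + 1)))"
    by (simp add: wp_def evaluates.simps[of _ _ "LetIn e1 e2"]) blast
  show "wp P env (Call k e) Q \<longleftrightarrow>
      wp P env e (\<lambda>w t1. wp_call P k w (\<lambda>v t2. Q v (t1 + t2 + 1)))"
    by (simp add: wp_def wp_call_def evaluates.simps[of _ _ "Call k e"]) blast
qed

text \<open>\<open>wp\<close> tracks exact step counts; here they are weakened to an upper bound, so
  that specifications of functions compose by plain arithmetic.\<close>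

definition returns :: "program \<Rightarrow> nat \<Rightarrow> val \<Rightarrow> val \<Rightarrow> nat \<Rightarrow> bool" where
  "returns P f w v B \<longleftrightarrow> wp_call P f w (\<lambda>v' t. v' = v \<and> t \<le> B)"

lemma wp_callI: "returns P f w v B \<Longrightarrow> (\<And>t. t \<le> B \<Longrightarrow> Q v t) \<Longrightarrow> wp_call P f w Q"
  unfolding returns_def wp_call_def wp_def by blast

lemma returns_mono: "returns P f w v B \<Longrightarrow> B \<le> B' \<Longrightarrow> returns P f w v B'"
  unfolding returns_def wp_call_def wp_def using order_trans by blast

section \<open>The program\<close>

abbreviation "fst_of \<equiv> Op1 Fst"
abbreviation "snd_of \<equiv> Op1 Snd"
abbreviation "is_cell \<equiv> Op1 IsCell"
abbreviation "cell \<equiv> Op2 MkCell"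
text \<open>Truncated subtraction stands in for an equality test: the sum of both differences is
  zero exactly for equal numbers.\<close>

abbreviation "differ a b \<equiv> Op2 Add (Op2 Sub a b) (Op2 Sub b a)"

text \<open>Components of an argument \<open>(x, (y, (z, ...)))\<close> passed as variable \<open>i\<close>.\<close>

abbreviation "arg0 i \<equiv> fst_of (Var i)"
abbreviation "rest0 i \<equiv> snd_of (Var i)"
abbreviation "arg1 i \<equiv> fst_of (rest0 i)"
abbreviation "rest1 i \<equiv> snd_of (rest0 i)"
abbreviation "arg2 i \<equiv> fst_of (rest1 i)"
abbreviation "rest2 i \<equiv> snd_of (rest1 i)"
abbreviation "arg3 i \<equiv> fst_of (rest2 i)"
abbreviation "rest3 i \<equiv> snd_of (rest2 i)"

text \<open>\<open>runs\<close> starts function 0, which fixes the number of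
  \<open>MAIN\<close>.\<close>

definition "MAIN = (0::nat)"
definition "MEM = (1::nat)"
definition "APPEND = (2::nat)"
definition "MERGE = (3::nat)"
definition "BLOCKS = (4::nat)"
definition "SINGLES = (5::nat)"
definition "ADD_ROOT = (6::nat)"
definition "LENGTH = (7::nat)"
definition "TOTAL = (8::nat)"
definition "TRIVIAL = (9::nat)"
definition "SOLVE = (10::nat)"
definition "SOLVE_BLOCKS = (11::nat)"
definition "TRY_ROOTS = (12::nat)"
definition "FUEL = (13::nat)"
definition "RANGE = (14::nat)"
definition "LOOKUP = (15::nat)"
definition "OUTPUT = (16::nat)"

lemmas fun_defs = MAIN_def MEM_def APPEND_def MERGE_def BLOCKS_def SINGLES_def ADD_ROOT_def
  LENGTH_def TOTAL_def TRIVIAL_def SOLVE_def SOLVE_BLOCKS_def TRY_ROOTS_def FUEL_def RANGE_def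
  LOOKUP_def OUTPUT_def

text \<open>Below the \<open>LetIn\<close>, variable 0 is the vertex list and variable 1 the
  instance; \<open>Const 0\<close> doubles as the empty list.\<close>

definition "main_body =
  LetIn (Call RANGE (cell (arg0 0) (Const 0)))
    (Call OUTPUT (cell (Var 0)
      (Call SOLVE (cell (Call FUEL (cell (arg0 1) (cell (Const 1) (Const 0))))
        (cell (rest0 1) (Var 0))))))"

definition "mem_body =
  IfZero (is_cell (rest0 0)) (Const 0)
    (IfZero (differ (arg0 0) (arg1 0)) (Const 1)
      (Call MEM (cell (arg0 0) (rest1 0))))"

definition "append_body =
  IfZero (is_cell (arg0 0)) (rest0 0)
    (cell (fst_of (arg0 0)) (Call APPEND (cell (snd_of (arg0 0)) (rest0 0))))"

definition "merge_body =
  IfZero (is_cell (arg2 0)) (IfZero (is_cell (rest2 0)) (Const 0) (cell (rest2 0) (Const 0)))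
    (IfZero (Op2 Add (Call MEM (cell (arg0 0) (fst_of (arg2 0))))
                     (Call MEM (cell (arg1 0) (fst_of (arg2 0)))))
      (cell (fst_of (arg2 0))
        (Call MERGE (cell (arg0 0) (cell (arg1 0) (cell (snd_of (arg2 0)) (rest2 0))))))
      (Call MERGE (cell (arg0 0) (cell (arg1 0) (cell (snd_of (arg2 0))
        (Call APPEND (cell (fst_of (arg2 0)) (rest2 0))))))))"

definition "blocks_body =
  IfZero (is_cell (arg0 0)) (rest0 0)
    (Call BLOCKS (cell (snd_of (arg0 0))
      (Call MERGE (cell (fst_of (fst_of (arg0 0))) (cell (snd_of (fst_of (arg0 0)))
        (cell (rest0 0) (Const 0)))))))"

definition "singles_body =
  IfZero (is_cell (rest0 0)) (Const 0)
    (IfZero (differ (arg1 0) (arg0 0))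
      (Call SINGLES (cell (arg0 0) (rest1 0)))
      (cell (cell (arg1 0) (Const 0)) (Call SINGLES (cell (arg0 0) (rest1 0)))))"

definition "add_root_body =
  IfZero (is_cell (arg1 0)) (rest1 0)
    (cell (cell (fst_of (fst_of (arg1 0))) (cell (arg0 0) (snd_of (fst_of (arg1 0)))))
      (Call ADD_ROOT (cell (arg0 0) (cell (snd_of (arg1 0)) (rest1 0)))))"

definition "length_body =
  IfZero (is_cell (Var 0)) (Const 0) (Op2 Add (Const 1) (Call LENGTH (rest0 0)))"

definition "total_body =
  IfZero (is_cell (Var 0)) (Const 0)
    (Op2 Add (Call LENGTH (snd_of (arg0 0))) (Call TOTAL (rest0 0)))"

definition "trivial_body =
  IfZero (is_cell (arg0 0)) (Const 0)
    (cell (cell (fst_of (arg0 0)) (rest0 0)) (Call TRIVIAL (cell (snd_of (arg0 0)) (rest0 0))))"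

text \<open>\<open>TRY_ROOTS\<close> receives the vertex list twice: as the fixed vertex set and as
  the list of roots still to be tried.\<close>

definition "solve_body =
  IfZero (arg0 0) (Call TRIVIAL (cell (rest1 0) (rest1 0)))
    (Call TRY_ROOTS (cell (Op2 Sub (arg0 0) (Const 1)) (cell (arg1 0) (cell (rest1 0)
      (cell (rest1 0) (Call TRIVIAL (cell (rest1 0) (rest1 0))))))))"

definition "solve_blocks_body =
  IfZero (is_cell (rest2 0)) (Const 0)
    (Call ADD_ROOT (cell (arg2 0)
      (cell (Call SOLVE (cell (arg0 0) (cell (arg1 0) (arg3 0))))
        (Call SOLVE_BLOCKS (cell (arg0 0) (cell (arg1 0) (cell (arg2 0) (rest3 0))))))))"

definition "try_roots_body =
  IfZero (is_cell (arg3 0)) (rest3 0)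
    (LetIn
      (cell (cell (fst_of (arg3 0)) (cell (fst_of (arg3 0)) (Const 0)))
        (Call SOLVE_BLOCKS (cell (arg0 0) (cell (arg1 0) (cell (fst_of (arg3 0))
          (Call BLOCKS (cell (arg1 0) (Call SINGLES (cell (fst_of (arg3 0)) (arg2 0))))))))))
      (Call TRY_ROOTS (cell (arg0 1) (cell (arg1 1) (cell (arg2 1) (cell (snd_of (arg3 1))
        (IfZero (Op2 Leq (Call TOTAL (Var 0)) (Call TOTAL (rest3 1))) (rest3 1) (Var 0))))))))"

text \<open>Without multiplication or logarithms, a power of two is doubled until it exceeds
  \<open>n\<close>, and each doubling earns 12 units of fuel.\<close>

definition "fuel_body =
  IfZero (Op2 Leq (arg1 0) (arg0 0)) (rest1 0)
    (Call FUEL (cell (arg0 0) (cell (Op2 Add (arg1 0) (arg1 0))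
      (Op2 Add (rest1 0) (Const 12)))))"

definition "range_body =
  IfZero (arg0 0) (rest0 0)
    (Call RANGE (cell (Op2 Sub (arg0 0) (Const 1))
      (cell (Op2 Sub (arg0 0) (Const 1)) (rest0 0))))"

definition "lookup_body =
  IfZero (is_cell (rest0 0)) (Const 0)
    (IfZero (differ (arg0 0) (fst_of (arg1 0))) (snd_of (arg1 0))
      (Call LOOKUP (cell (arg0 0) (rest1 0))))"

definition "output_body =
  IfZero (is_cell (arg0 0)) (Const 0)
    (cell (Call LOOKUP (cell (fst_of (arg0 0)) (rest0 0)))
      (Call OUTPUT (cell (snd_of (arg0 0)) (rest0 0))))"

definition prog :: program where
  "prog = [main_body, mem_body, append_body, merge_body, blocks_body, singles_body, add_root_body, length_body, total_body, trivial_body, solve_body, solve_blocks_body, try_roots_body, fuel_body, range_body, lookup_body, output_body]"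

lemma prog_nth:
  "prog ! MAIN = main_body"
  "prog ! MEM = mem_body"
  "prog ! APPEND = append_body"
  "prog ! MERGE = merge_body"
  "prog ! BLOCKS = blocks_body"
  "prog ! SINGLES = singles_body"
  "prog ! ADD_ROOT = add_root_body"
  "prog ! LENGTH = length_body"
  "prog ! TOTAL = total_body"
  "prog ! TRIVIAL = trivial_body"
  "prog ! SOLVE = solve_body"
  "prog ! SOLVE_BLOCKS = solve_blocks_body"
  "prog ! TRY_ROOTS = try_roots_body"
  "prog ! FUEL = fuel_body"
  "prog ! RANGE = range_body"
  "prog ! LOOKUP = lookup_body"
  "prog ! OUTPUT = output_body"
  by (simp_all add: prog_def fun_defs)

lemma fun_less:
  "MAIN < 17" "MEM < 17" "APPEND < 17" "MERGE < 17" "BLOCKS < 17" "SINGLES < 17" "ADD_ROOT < 17" "LENGTH < 17" "TOTAL < 17" "TRIVIAL < 17" "SOLVE < 17" "SOLVE_BLOCKS < 17" "TRY_ROOTS < 17" "FUEL < 17" "RANGE < 17" "LOOKUP < 17" "OUTPUT < 17"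
  by (simp_all add: fun_defs)

lemma length_prog: "length prog = 17"
  by (simp add: prog_def)

lemma differ_zero_iff: "a \<le> b \<and> b \<le> a \<longleftrightarrow> a = (b::nat)"
  by auto

lemma returns_prog_iff:
  "returns prog f w v B \<longleftrightarrow> f < 17 \<and> wp prog [w] (prog ! f) (\<lambda>v' t. v' = v \<and> t \<le> B)"
  by (simp add: returns_def wp_call_def length_prog)

section \<open>Values and step counts of the subroutines\<close>

abbreviation enc_nats :: "nat list \<Rightarrow> val" where
  "enc_nats l \<equiv> enc_list (map Atom l)"

abbreviation enc_edges :: "(nat \<times> nat) list \<Rightarrow> val" where
  "enc_edges es \<equiv> enc_list (map (\<lambda>(a, b). Cell (Atom a) (Atom b)) es)"

abbreviation enc_blocks :: "nat list list \<Rightarrow> val" where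
  "enc_blocks Bs \<equiv> enc_list (map (\<lambda>B. enc_nats B) Bs)"

abbreviation enc_labels :: "(nat \<times> nat list) list \<Rightarrow> val" where
  "enc_labels lab \<equiv> enc_list (map (\<lambda>(u, h). Cell (Atom u) (enc_nats h)) lab)"

lemmas exec = returns_prog_iff wp_simps differ_zero_iff prog_nth fun_less

lemma returns_mem:
  "returns prog MEM (Cell (Atom x) (enc_nats xs)) (Atom (of_bool (x \<in> set xs)))
    (40 * (length xs + 1))"
proof (induction xs)
  case Nil
  then show ?case by (simp add: exec mem_body_def)
next
  case (Cons y xs)
  show ?case
  proof (cases "x = y")
    case True
    then show ?thesis by (simp add: exec mem_body_def)
  next
    case False
    then show ?thesis
      by (simp add: exec mem_body_def split del: split_of_bool) (rule wp_callI[OF Cons], simp)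
  qed
qed

lemma returns_append:
  "returns prog APPEND (Cell (enc_nats xs) (enc_nats ys)) (enc_nats (xs @ ys)) (40 * (length xs + 1))"
proof (induction xs)
  case (Cons x xs)
  show ?case by (simp add: exec append_body_def) (rule wp_callI[OF Cons], simp)
qed (simp add: exec append_body_def)

lemma returns_merge:
  "returns prog MERGE (Cell (Atom a) (Cell (Atom b) (Cell (enc_blocks Bs) (enc_nats acc))))
    (enc_blocks (merge_blocks a b Bs acc)) (200 * (length (concat Bs) + length Bs + 1))"
proof (induction a b Bs acc rule: merge_blocks.induct)
  case (1 a b acc)
  then show ?case by (cases acc) (simp_all add: exec merge_body_def)
next
  case (2 a b B Bs acc)
  show ?case
  proof (cases "a \<in> set B \<or> b \<in> set B")
    case True
    then have "\<not> (a \<notin> set B \<and> b \<notin> set B)" by blast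
    then show ?thesis
      apply (simp add: exec merge_body_def)
      apply (rule wp_callI[OF returns_mem])+
      apply (simp add: exec)
      apply (rule conjI, blast)
      apply (rule wp_callI[OF returns_append])
      apply (rule wp_callI[OF 2(1)[OF True]])
      apply simp
      done
  next
    case False
    then show ?thesis
      apply (simp add: exec merge_body_def)
      apply (rule wp_callI[OF returns_mem])+
      apply (simp add: exec)
      apply (rule wp_callI[OF 2(2)[OF False]])
      apply simp
      done
  qed
qed

lemma length_merge_blocks: "length (merge_blocks a b Bs acc) \<le> length Bs + of_bool (acc \<noteq> [])"
  by (induction a b Bs acc rule: merge_blocks.induct) (auto simp: of_bool_def split: if_splits)

lemma length_blocks: "length (blocks es Bs) \<le> length Bs"
proof (induction es Bs rule: blocks.induct)
  case (2 a b es Bs)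
  then show ?case using length_merge_blocks[of a b Bs "[]"] by simp
qed simp

text \<open>One \<open>M\<close> serves all rounds: a merge keeps the total length and, starting
  from an empty accumulator, does not increase the number of blocks.\<close>

lemma returns_blocks:
  "length (concat Bs) + length Bs + 1 \<le> M \<Longrightarrow>
    returns prog BLOCKS (Cell (enc_edges es) (enc_blocks Bs)) (enc_blocks (blocks es Bs))
      (300 * M * (length es + 1))"
proof (induction es Bs rule: blocks.induct)
  case (1 Bs)
  then show ?case by (simp add: exec blocks_body_def)
next
  case (2 a b es Bs)
  have "length (concat (merge_blocks a b Bs [])) = length (concat Bs)"
    using mset_eq_length[OF mset_merge_blocks[of a b Bs "[]", simplified add_0_right mset.simps]] .
  then have "returns prog BLOCKS (Cell (enc_edges es) (enc_blocks (merge_blocks a b Bs [])))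
      (enc_blocks (blocks es (merge_blocks a b Bs []))) (300 * M * (length es + 1))"
    using 2 length_merge_blocks[of a b Bs "[]"] by simp
  note rec = wp_callI[OF this]
  show ?case using 2(2)
    apply (simp add: exec blocks_body_def)
    apply (rule wp_callI[OF returns_merge[where acc = "[]", simplified list.map enc_list.simps]])
    apply (rule rec)
    apply (simp add: algebra_simps)
    done
qed

lemma returns_singles:
  "returns prog SINGLES (Cell (Atom r) (enc_nats vs)) (enc_blocks (singles r vs))
    (60 * (length vs + 1))"
proof (induction vs)
  case Nil
  then show ?case by (simp add: exec singles_body_def singles_def)
next
  case (Cons v vs)
  show ?case
    by (cases "v = r"; simp add: exec singles_body_def; rule wp_callI[OF Cons])
      (simp_all add: singles_def)
qed

lemma returns_add_root:
  "returns prog ADD_ROOT (Cell (Atom r) (Cell (enc_labels lab) (enc_labels acc)))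
    (enc_labels (add_root r lab @ acc)) (60 * (length lab + 1))"
proof (induction lab)
  case Nil
  then show ?case by (simp add: exec add_root_body_def add_root_def)
next
  case (Cons p lab)
  obtain u h where "p = (u, h)" by force
  then show ?case
    by (simp add: exec add_root_body_def) (rule wp_callI[OF Cons], simp add: add_root_def)
qed

lemma returns_length:
  "returns prog LENGTH (enc_nats xs) (Atom (length xs)) (20 * (length xs + 1))"
proof (induction xs)
  case (Cons x xs)
  show ?case by (simp add: exec length_body_def) (rule wp_callI[OF Cons], simp)
qed (simp add: exec length_body_def)

lemma returns_total:
  "returns prog TOTAL (enc_labels lab) (Atom (total_length lab))
    (60 * (total_length lab + length lab + 1))"
proof (induction lab)
  case Nil
  then show ?case by (simp add: exec total_body_def total_length_def)
next
  case (Cons p lab)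
  obtain u h where "p = (u, h)" by force
  then show ?case
    by (simp add: exec total_body_def)
      (rule wp_callI[OF returns_length], rule wp_callI[OF Cons], simp add: total_length_def)
qed

lemma returns_trivial:
  "returns prog TRIVIAL (Cell (enc_nats us) (enc_nats vs)) (enc_labels (map (\<lambda>u. (u, vs)) us))
    (40 * (length us + 1))"
proof (induction us)
  case (Cons u us)
  show ?case by (simp add: exec trivial_body_def) (rule wp_callI[OF Cons], simp add: o_def)
qed (simp add: exec trivial_body_def)

text \<open>The hypotheses make \<open>L\<close> the exact number of doublings still to come:
  \<open>p * 2 ^ L\<close> is the first multiple to exceed \<open>n\<close>.\<close>

lemma returns_fuel:
  "n < p * 2 ^ L \<Longrightarrow> (\<And>i. i < L \<Longrightarrow> p * 2 ^ i \<le> n) \<Longrightarrow>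
    returns prog FUEL (Cell (Atom n) (Cell (Atom p) (Atom d))) (Atom (d + 12 * L)) (60 * (L + 1))"
proof (induction L arbitrary: p d)
  case 0
  then show ?case by (simp add: exec fuel_body_def)
next
  case (Suc L)
  have "(p + p) * 2 ^ i \<le> n" if "i < L" for i
    using Suc.prems(2)[of "Suc i"] that by (simp add: algebra_simps)
  then have "returns prog FUEL (Cell (Atom n) (Cell (Atom (p + p)) (Atom (d + 12))))
      (Atom (d + 12 + 12 * L)) (60 * (L + 1))"
    using Suc.prems(1) by (intro Suc.IH) (simp_all add: algebra_simps)
  note rec = wp_callI[OF this]
  show ?case using Suc.prems(2)[of 0]
    by (simp add: exec fuel_body_def) (rule rec, simp)
qed

lemma returns_range:
  "returns prog RANGE (Cell (Atom k) (enc_nats acc)) (enc_nats ([0..<k] @ acc)) (60 * (k + 1))"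
proof (induction k arbitrary: acc)
  case 0
  then show ?case by (simp add: exec range_body_def)
next
  case (Suc k)
  show ?case
    using wp_callI[OF Suc[of "k # acc"]] by (simp add: exec range_body_def)
qed

lemma returns_lookup:
  "map_of lab u = Some h \<Longrightarrow>
    returns prog LOOKUP (Cell (Atom u) (enc_labels lab)) (enc_nats h) (60 * (length lab + 1))"
proof (induction lab)
  case (Cons p lab)
  obtain v g where p: "p = (v, g)" by force
  show ?case
  proof (cases "u = v")
    case True
    then show ?thesis using Cons.prems p by (simp add: exec lookup_body_def)
  next
    case False
    then have "map_of lab u = Some h" using Cons.prems p by simp
    then show ?thesis using False p
      by (simp add: exec lookup_body_def) (rule wp_callI[OF Cons.IH], simp_all)
  qed
qed simp

lemma returns_output:
  "set us \<subseteq> fst ` set lab \<Longrightarrow>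
    returns prog OUTPUT (Cell (enc_nats us) (enc_labels lab))
      (enc_list (map (\<lambda>u. enc_nats (the (map_of lab u))) us)) (60 * (length lab + 2) * (length us + 1))"
proof (induction us)
  case Nil
  then show ?case by (simp add: exec output_body_def)
next
  case (Cons u us)
  then have "map_of lab u = Some (the (map_of lab u))"
    by (metis list.set_intros(1) map_of_eq_None_iff option.collapse subsetD)
  note lookup = wp_callI[OF returns_lookup[OF this]]
  have "set us \<subseteq> fst ` set lab" using Cons.prems by simp
  note rec = wp_callI[OF Cons.IH[OF this]]
  show ?case
    by (simp add: exec output_body_def) (rule lookup, rule rec, simp add: algebra_simps)
qed

section \<open>Running time of the recursion\<close>

lemma returns_solve_blocks:
  assumes "\<And>B. B \<in> set Bs \<Longrightarrow> length (f B) \<le> M \<and>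
    returns prog SOLVE (Cell (Atom d) (Cell (enc_edges es) (enc_nats B))) (enc_labels (f B)) W"
  shows "returns prog SOLVE_BLOCKS
    (Cell (Atom d) (Cell (enc_edges es) (Cell (Atom r) (enc_blocks Bs))))
    (enc_labels (concat (map (\<lambda>B. add_root r (f B)) Bs))) ((W + 60 * (M + 2)) * (length Bs + 1))"
  using assms
proof (induction Bs)
  case Nil
  then show ?case by (simp add: exec solve_blocks_body_def)
next
  case (Cons B Bs)
  have B: "returns prog SOLVE (Cell (Atom d) (Cell (enc_edges es) (enc_nats B))) (enc_labels (f B)) W"
    "length (f B) \<le> M" using Cons.prems by auto
  have rec: "returns prog SOLVE_BLOCKS
    (Cell (Atom d) (Cell (enc_edges es) (Cell (Atom r) (enc_blocks Bs))))
    (enc_labels (concat (map (\<lambda>B. add_root r (f B)) Bs))) ((W + 60 * (M + 2)) * (length Bs + 1))"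
    using Cons by simp
  show ?case using B(2)
    apply (simp add: exec solve_blocks_body_def)
    apply (rule wp_callI[OF B(1)])
    apply (rule wp_callI[OF rec])
    apply (rule wp_callI[OF returns_add_root])
    apply (simp add: algebra_simps)
    done
qed

text \<open>\<open>R\<close> bounds the work for one root, term by term: \<open>SINGLES\<close>,
  \<open>BLOCKS\<close>, \<open>SOLVE_BLOCKS\<close> with \<open>W\<close> per recursive call, two
  calls of \<open>TOTAL\<close>, and the evaluation of the body. \<open>T\<close> bounds the size of
  every labeling compared, \<open>M\<close> the length of the recursive results.\<close>

lemma returns_try_roots:
  fixes W T M d :: nat and es vs f
  defines "R \<equiv> 60 * (length vs + 1) + 300 * (2 * length vs + 1) * (length es + 1)
    + (W + 60 * (M + 2)) * (length vs + 1) + 120 * (T + 1) + 200"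
  assumes "total_length best + length best \<le> T"
    and "\<And>r. r \<in> set rs \<Longrightarrow>
      total_length (candidate es f vs r) + length (candidate es f vs r) \<le> T \<and>
      (\<forall>B\<in>set (blocks es (singles r vs)). length (f B) \<le> M \<and>
        returns prog SOLVE (Cell (Atom d) (Cell (enc_edges es) (enc_nats B))) (enc_labels (f B)) W)"
  shows "returns prog TRY_ROOTS
    (Cell (Atom d) (Cell (enc_edges es) (Cell (enc_nats vs) (Cell (enc_nats rs) (enc_labels best)))))
    (enc_labels (foldl (\<lambda>best r. cheaper best (candidate es f vs r)) best rs)) (R * (length rs + 1))"
  using assms(2,3)
proof (induction rs arbitrary: best)
  case Nil
  then show ?case by (simp add: exec try_roots_body_def R_def)
next
  case (Cons r rs)
  define Bs where "Bs = blocks es (singles r vs)"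
  define c where "c = candidate es f vs r"
  have enc_c: "enc_labels c
      = Cell (Cell (Atom r) (Cell (Atom r) (Atom 0))) (enc_labels (concat (map (\<lambda>B. add_root r (f B)) Bs)))"
    by (simp add: c_def candidate_def Bs_def)
  have singles: "length (concat (singles r vs)) \<le> length vs" "length (singles r vs) \<le> length vs"
    unfolding concat_singles by (simp_all add: singles_def)
  have blocks: "returns prog BLOCKS (Cell (enc_edges es) (enc_blocks (singles r vs)))
      (enc_blocks Bs) (300 * (2 * length vs + 1) * (length es + 1))"
    unfolding Bs_def using singles by (intro returns_blocks) linarith
  have len: "length Bs \<le> length vs" using length_blocks[of es "singles r vs"] singles Bs_def by simp
  have "returns prog SOLVE_BLOCKS (Cell (Atom d) (Cell (enc_edges es) (Cell (Atom r) (enc_blocks Bs))))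
    (enc_labels (concat (map (\<lambda>B. add_root r (f B)) Bs))) ((W + 60 * (M + 2)) * (length Bs + 1))"
    using Cons.prems(2)[of r] by (intro returns_solve_blocks) (simp add: Bs_def)
  then have solve_blocks: "returns prog SOLVE_BLOCKS
    (Cell (Atom d) (Cell (enc_edges es) (Cell (Atom r) (enc_blocks Bs))))
    (enc_labels (concat (map (\<lambda>B. add_root r (f B)) Bs))) ((W + 60 * (M + 2)) * (length vs + 1))"
    by (rule returns_mono) (use len in \<open>intro mult_le_mono2, simp\<close>)
  have c: "total_length c + length c \<le> T" using Cons.prems(2)[of r] c_def by simp
  have rec: "returns prog TRY_ROOTS
    (Cell (Atom d) (Cell (enc_edges es) (Cell (enc_nats vs) (Cell (enc_nats rs)
      (enc_labels (cheaper best c))))))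
    (enc_labels (foldl (\<lambda>best r. cheaper best (candidate es f vs r)) (cheaper best c) rs))
    (R * (length rs + 1))"
    using Cons.prems c by (intro Cons.IH) (auto simp: cheaper_def)
  \<comment> \<open>Naming the products keeps them opaque, so that the final comparison of step
    counts is linear.\<close>
  define Kb where "Kb = 300 * (2 * length vs + 1) * (length es + 1)"
  define Ks where "Ks = (W + 60 * (M + 2)) * (length vs + 1)"
  have R: "R = 60 * (length vs + 1) + Kb + Ks + 120 * (T + 1) + 200"
    by (simp add: R_def Kb_def Ks_def)
  show ?case
  proof (cases "total_length c \<le> total_length best")
    case True
    have best: "cheaper best c = c" using True by (simp add: cheaper_def)
    show ?thesis
      using Cons.prems(1) c True
      apply (simp add: exec try_roots_body_def)
      apply (rule wp_callI[OF returns_singles])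
      apply (rule wp_callI[OF blocks[folded Kb_def]])
      apply (rule wp_callI[OF solve_blocks[folded Ks_def]])
      apply (simp add: exec enc_c[symmetric])
      apply (rule wp_callI[OF returns_total])
      apply (rule wp_callI[OF returns_total])
      apply (simp add: exec)
      apply (rule wp_callI[OF rec[unfolded best]])
      apply (simp add: best flip: c_def)
      apply (simp add: R)
      done
  next
    case False
    have best: "cheaper best c = best" using False by (simp add: cheaper_def)
    show ?thesis
      using Cons.prems(1) c False
      apply (simp add: exec try_roots_body_def)
      apply (rule wp_callI[OF returns_singles])
      apply (rule wp_callI[OF blocks[folded Kb_def]])
      apply (rule wp_callI[OF solve_blocks[folded Ks_def]])
      apply (simp add: exec enc_c[symmetric])
      apply (rule wp_callI[OF returns_total])
      apply (rule wp_callI[OF returns_total])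
      apply (simp add: exec)
      apply (rule wp_callI[OF rec[unfolded best]])
      apply (simp add: best flip: c_def)
      apply (simp add: R)
      done
  qed
qed

lemma total_length_le:
  "(\<And>u h. (u, h) \<in> set lab \<Longrightarrow> length h \<le> m) \<Longrightarrow> total_length lab \<le> length lab * m"
proof (induction lab)
  case (Cons p lab)
  obtain u h where "p = (u, h)" by force
  then show ?case using Cons by (fastforce simp: total_length_def intro: add_mono)
qed (simp add: total_length_def)

text \<open>One level multiplies the time by N^3: a factor N for the roots, a factor N for the
  blocks of each root, and a last one, at least 2, that absorbs the overhead.\<close>

lemma solve_step_bound:
  fixes N W l E n :: nat
  assumes "2 \<le> N" "2000 * N ^ 4 \<le> W" "l + 2 \<le> N" "E + 1 \<le> N ^ 2" "n + 2 = N"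
  shows "(60 * (l + 1) + 300 * (2 * l + 1) * (E + 1) + (W + 60 * (n + 2)) * (l + 1)
    + 120 * (n * n + n + 1) + 200) * (l + 1) + 40 * (l + 1) + 100 \<le> W * N ^ 3" (is "?R * _ + _ + _ \<le> _")
proof -
  have N: "N \<le> N ^ 3" "N ^ 2 \<le> N ^ 3" "1 \<le> N ^ 3" "N \<le> N ^ 4" "1 \<le> N ^ 4"
    using assms(1) power_increasing[of 1 3 N] power_increasing[of 2 3 N] power_increasing[of 1 4 N]
    by auto
  have "300 * (2 * l + 1) * (E + 1) \<le> 300 * (2 * N) * N ^ 2"
    using assms by (intro mult_le_mono) auto
  moreover have "(W + 60 * (n + 2)) * (l + 1) \<le> (W + 60 * N) * N"
    using assms by (intro mult_le_mono) auto
  moreover have "n * n + n + 1 \<le> N ^ 2"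
    using assms(5) by (auto simp: power2_eq_square algebra_simps)
  ultimately have "?R \<le> 60 * N + 300 * (2 * N) * N ^ 2 + (W + 60 * N) * N + 120 * N ^ 2 + 200"
    using assms(3) by (intro add_mono) auto
  also have "\<dots> = W * N + 600 * N ^ 3 + 180 * N ^ 2 + 60 * N + 200"
    by (simp add: algebra_simps power2_eq_square power3_eq_cube)
  also have "\<dots> \<le> W * N + 1040 * N ^ 3" using N by linarith
  finally have "?R * (l + 1) \<le> (W * N + 1040 * N ^ 3) * N"
    using assms(3) by (intro mult_le_mono) auto
  also have "\<dots> = W * N ^ 2 + 1040 * N ^ 4"
    by (simp add: algebra_simps power2_eq_square eval_nat_numeral)
  finally have step: "?R * (l + 1) \<le> W * N ^ 2 + 1040 * N ^ 4" .
  \<comment> \<open>960 is what is left of the 2000 in the lower bound on \<open>W\<close> after the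
    1040 = 600 + 180 + 60 + 200 collected above.\<close>
  have "40 * (l + 1) + 100 \<le> 960 * N" using assms(1,3) by simp
  also have "\<dots> \<le> 960 * N ^ 4" using N(4) by (rule mult_le_mono2)
  finally have "40 * (l + 1) + 100 \<le> 960 * N ^ 4" .
  from add_mono[OF step this]
  have "?R * (l + 1) + 40 * (l + 1) + 100 \<le> (W * N ^ 2 + 1040 * N ^ 4) + 960 * N ^ 4"
    by (simp only: add.assoc)
  also have "\<dots> = W * N ^ 2 + 2000 * N ^ 4" by simp
  also have "\<dots> \<le> W * N ^ 2 + W * N ^ 2"
    using assms(1,2) by (intro add_left_mono) (simp add: le_trans[OF assms(2)])
  also have "\<dots> = W * N ^ 2 * 2" by simp
  also have "\<dots> \<le> W * N ^ 2 * N" using assms(1) by (intro mult_le_mono) auto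
  also have "\<dots> = W * N ^ 3" by (simp add: power2_eq_square power3_eq_cube)
  finally show ?thesis .
qed

text \<open>\<open>N\<close> is tied to the whole tree and not to the current component, so one
  bound fits all calls of a level; N^4 covers the base case and the overhead of a level, and each
  unit of fuel contributes N^3.\<close>

lemma returns_solve:
  fixes V :: "nat set" and N :: nat
  assumes T: "tree_edges V P es" and N: "card V + 2 = N" and E: "length es + 1 \<le> N ^ 2"
  shows "path_system.convex V P (set vs) \<Longrightarrow> distinct vs \<Longrightarrow>
    returns prog SOLVE (Cell (Atom d) (Cell (enc_edges es) (enc_nats vs)))
      (enc_labels (solve es d vs)) (2000 * N ^ (3 * d + 4))"
proof (induction d arbitrary: vs)
  interpret tree_edges V P es using T .
  have len: "length vs + 2 \<le> N" if "convex (set vs)" "distinct vs" for vs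
    using card_mono[of V "set vs"] that finite_V N by (simp add: convex_def distinct_card)
  {
    case 0
    have "N \<le> N ^ 4" "1 \<le> N ^ 4" using N power_increasing[of 1 4 N] by auto
    moreover have "length vs + 2 \<le> N" using len 0 by simp
    ultimately have "100 + 40 * length vs \<le> 2000 * N ^ 4" by linarith
    then show ?case
      by (simp add: exec solve_body_def)
        (rule wp_callI[OF returns_trivial], simp add: trivial_labels_def)
  next
    case (Suc d)
    define W where "W = 2000 * N ^ (3 * d + 4)"
    define n where "n = card V"
    have l: "length vs + 2 \<le> N" using len Suc.prems by simp
    have W: "2000 * N ^ 4 \<le> W" using N by (simp add: W_def)
    \<comment> \<open>At most \<open>n\<close> vertices with at most \<open>n\<close> hubs each,
      plus one list entry per vertex.\<close>
    have small: "total_length lab + length lab \<le> n * n + n" if "valid vs lab" for lab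
    proof -
      have "length lab \<le> n" using valid_fst(3)[OF that Suc.prems(2)] l N n_def by simp
      moreover have "total_length lab \<le> length lab * length vs"
        using valid_hubs(3)[OF that Suc.prems(2)] by (intro total_length_le) auto
      moreover have "length vs \<le> n" using l N n_def by simp
      ultimately show ?thesis by (meson add_mono mult_le_mono order_trans)
    qed
    have blocks: "length (solve es d B) \<le> n \<and>
        returns prog SOLVE (Cell (Atom d) (Cell (enc_edges es) (enc_nats B))) (enc_labels (solve es d B)) W"
      if "r \<in> set vs" "B \<in> set (blocks es (singles r vs))" for r B
    proof -
      have B: "convex (set B)" "distinct B" using block_convex[OF Suc.prems that] by blast+
      then show ?thesis
        using Suc.IH[OF B] valid_fst(3)[OF valid_solve[OF B] B(2)] len[OF B] N
        by (simp add: W_def n_def)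
    qed
    have cand: "valid vs (candidate es (solve es d) vs r)" if "r \<in> set vs" for r
      using valid_candidate[OF Suc.prems that] valid_solve block_convex[OF Suc.prems that] by blast
    define R where "R = 60 * (length vs + 1) + 300 * (2 * length vs + 1) * (length es + 1)
      + (W + 60 * (n + 2)) * (length vs + 1) + 120 * (n * n + n + 1) + 200"
    have try_roots: "returns prog TRY_ROOTS
      (Cell (Atom d) (Cell (enc_edges es) (Cell (enc_nats vs) (Cell (enc_nats vs)
        (enc_labels (trivial_labels vs))))))
      (enc_labels (solve es (Suc d) vs)) (R * (length vs + 1))"
      using small valid_trivial_labels[OF Suc.prems] cand blocks
      unfolding R_def solve.simps by (intro returns_try_roots) auto
    have "R * (length vs + 1) + 40 * (length vs + 1) + 100 \<le> W * N ^ 3"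
      unfolding R_def by (rule solve_step_bound) (use l W E N n_def in auto)
    also have "\<dots> = 2000 * N ^ (3 * Suc d + 4)" by (simp add: W_def power_add)
    finally have bound: "R * (length vs + 1) + 40 * (length vs + 1) + 100 \<le> 2000 * N ^ (3 * Suc d + 4)" .
    define X where "X = 2000 * N ^ (3 * Suc d + 4)"
    define Y where "Y = R * (length vs + 1)"
    have bound: "Y + 40 * (length vs + 1) + 100 \<le> X" using bound by (simp only: X_def Y_def)
    show ?case
      unfolding X_def[symmetric] using bound
      apply (simp add: exec solve_body_def del: solve.simps)
      apply (rule wp_callI[OF returns_trivial])
      apply (rule wp_callI[OF try_roots[unfolded trivial_labels_def, folded Y_def]])
      apply (simp del: solve.simps)
      done
  }
qed

section \<open>The quasi-polynomial bound\<close>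

definition log_bound :: "nat \<Rightarrow> nat" where
  "log_bound n = (LEAST L. n < 2 ^ L)"

lemma log_bound: "n < 2 ^ log_bound n" "i < log_bound n \<Longrightarrow> 2 ^ i \<le> n" "log_bound n \<le> n"
proof -
  show "n < 2 ^ log_bound n" unfolding log_bound_def by (rule LeastI[of _ n]) simp
  show "2 ^ i \<le> n" if "i < log_bound n"
    using not_less_Least[of i "\<lambda>L. n < 2 ^ L"] that by (simp add: log_bound_def)
  show "log_bound n \<le> n" unfolding log_bound_def by (rule Least_le) simp
qed

text \<open>The exponent is 3 d + 4 at fuel d = 12 L. Of the factor 3000, 2000 is for the recursion
  and the rest covers range, fuel and output.\<close>

definition time_bound :: "nat \<Rightarrow> nat" where
  "time_bound n = 3000 * (n + 2) ^ (36 * log_bound n + 4)"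

text \<open>Counting ordered pairs is crude but fits below (n + 2)^2; distinct unordered edges come
  from distinct pairs.\<close>

lemma length_edges:
  assumes "is_tree {..<n} E" "represents_edges es E"
  shows "length es \<le> n * n"
proof -
  interpret tree_edges "{..<n}" "tree_path {..<n} E" es
    using tree_edges_tree_path[OF assms] .
  have "distinct es" using assms(2) by (simp add: represents_edges_def distinct_map)
  moreover have "set es \<subseteq> {..<n} \<times> {..<n}" using edge_in by auto
  ultimately show ?thesis
    using card_mono[of "{..<n} \<times> {..<n}" "set es"] by (simp add: distinct_card)
qed

lemma returns_main:
  assumes T: "is_tree {..<n} E" and es: "represents_edges es E"
  defines "lab \<equiv> solve es (12 * log_bound n) [0..<n]"
  shows "returns prog MAIN (enc_graph n es)
    (enc_list (map (\<lambda>u. enc_nats (the (map_of lab u))) [0..<n])) (time_bound n)"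
proof -
  interpret tree_edges "{..<n}" "tree_path {..<n} E" es
    using tree_edges_tree_path[OF T es] .
  define N where "N = n + 2"
  define L where "L = log_bound n"
  define W where "W = 2000 * N ^ (36 * L + 4)"
  have conv: "convex (set [0..<n])" using convex_V by (simp add: lessThan_atLeast0)
  have E: "length es + 1 \<le> N ^ 2"
    using length_edges[OF T es] by (simp add: N_def power2_eq_square)
  have solve: "returns prog SOLVE (Cell (Atom (12 * L)) (Cell (enc_edges es) (enc_nats [0..<n])))
      (enc_labels lab) W"
    using returns_solve[OF tree_edges_tree_path[OF T es] _ E conv, of "12 * L"]
    by (simp add: N_def W_def L_def lab_def)
  have lab: "fst ` set lab = {..<n}" "length lab = n"
    using valid_fst[OF valid_solve[OF conv], of "12 * log_bound n"] by (auto simp: lab_def)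
  have outputs: "returns prog OUTPUT (Cell (enc_nats [0..<n]) (enc_labels lab))
      (enc_list (map (\<lambda>u. enc_nats (the (map_of lab u))) [0..<n])) (60 * N * (n + 1))"
    using returns_output[of "[0..<n]" lab] lab by (simp add: N_def lessThan_atLeast0)
  have fuel: "returns prog FUEL (Cell (Atom n) (Cell (Atom 1) (Atom 0))) (Atom (12 * L)) (60 * (L + 1))"
    using returns_fuel[of n 1 L 0] log_bound(1)[of n] log_bound(2)[of _ n] by (simp add: L_def)
  have range: "returns prog RANGE (Cell (Atom n) (Atom 0)) (enc_nats [0..<n]) (60 * (n + 1))"
    using returns_range[of n "[]"] by simp
  define Z where "Z = 60 * N * (n + 1)"
  define A where "A = N ^ (36 * L + 4)"
  have "N * N \<le> A" "N \<le> A" "1 \<le> A"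
    using power_increasing[of 2 "36 * L + 4" N] power_increasing[of 1 "36 * L + 4" N]
    by (simp_all add: A_def N_def power2_eq_square)
  moreover have "Z \<le> 60 * (N * N)" by (simp add: Z_def N_def algebra_simps)
  moreover have "n + 1 \<le> N" "L + 1 \<le> N" using log_bound(3)[of n] by (simp_all add: L_def N_def)
  moreover have "time_bound n = 3000 * A" "W = 2000 * A"
    by (simp_all add: time_bound_def A_def L_def N_def W_def)
  ultimately have bound: "60 * (n + 1) + 60 * (L + 1) + W + Z + 100 \<le> time_bound n" by simp
  show ?thesis
    unfolding enc_graph_def using bound
    apply (simp add: exec main_body_def)
    apply (rule wp_callI[OF range])
    apply (simp add: exec)
    apply (rule wp_callI[OF fuel[unfolded One_nat_def]])
    apply (rule wp_callI[OF solve])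
    apply (rule wp_callI[OF outputs[folded Z_def]])
    apply simp
    done
qed

text \<open>The additional 2 steps are the evaluation of the argument variable and the initial call
  made by \<open>runs\<close>.\<close>

lemma solves_prog: "solves_HL1_on_trees prog (\<lambda>n. time_bound n + 2)"
  unfolding solves_HL1_on_trees_def
proof (intro allI impI)
  fix n E es assume T: "is_tree {..<n} E" and es: "represents_edges es E"
  interpret tree_edges "{..<n}" "tree_path {..<n} E" es
    using tree_edges_tree_path[OF T es] .
  define lab where "lab = solve es (12 * log_bound n) [0..<n]"
  have conv: "convex (set [0..<n])" using convex_V by (simp add: lessThan_atLeast0)
  have n: "[0..<n] \<noteq> []" using T by (auto simp: is_tree_def)
  define out where "out = enc_list (map (\<lambda>u. enc_nats (the (map_of lab u))) [0..<n])"
  obtain t where t: "t \<le> time_bound n" "evaluates prog [enc_graph n es] (prog ! MAIN) out t"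
    using returns_main[OF T es] unfolding returns_def wp_call_def wp_def lab_def out_def by blast
  have "runs prog (enc_graph n es) out (1 + t + 1)"
    unfolding runs_def
    using evaluates.Call[OF evaluates.Var[of 0 "[enc_graph n es]" prog], of 0 out t] t(2) length_prog
    by (simp add: MAIN_def)
  moreover have "represents_labeling n out (label_of lab)"
    unfolding represents_labeling_def
  proof (intro exI conjI)
    have lab: "valid [0..<n] lab" using valid_solve[OF conv] by (simp add: lab_def)
    show "out = enc_list (map (\<lambda>l. enc_nats l) (map (\<lambda>u. the (map_of lab u)) [0..<n]))"
      by (simp add: out_def o_def)
    show "\<forall>u<n. distinct (map (\<lambda>u. the (map_of lab u)) [0..<n] ! u) \<and>
        set (map (\<lambda>u. the (map_of lab u)) [0..<n] ! u) = label_of lab u"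
    proof (intro allI impI conjI)
      fix u assume u: "u < n"
      then have "u \<in> fst ` set lab" using valid_fst(2)[OF lab] by simp
      then obtain h where h: "(u, h) \<in> set lab" by force
      then have "map_of lab u = Some h" using valid_fst(1)[OF lab] by simp
      then show "distinct (map (\<lambda>u. the (map_of lab u)) [0..<n] ! u)"
        using valid_hubs(1)[OF lab _ h] u by simp
      show "set (map (\<lambda>u. the (map_of lab u)) [0..<n] ! u) = label_of lab u"
        using u by (simp add: label_of_def)
    qed
  qed simp
  moreover have "optimal_HL1 {..<n} E (label_of lab)"
  proof -
    have "labeling {..<n} H \<longleftrightarrow> hub_labeling {..<n} E H" for H
      by (auto simp: labeling_def hub_labeling_def)
    moreover have "optimal {..<n} (label_of lab)"
      using optimal_solve_log[OF conv _ n, of "log_bound n"] log_bound(1)[of n]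
      by (simp add: lab_def lessThan_atLeast0)
    ultimately show ?thesis by (simp add: optimal_def optimal_HL1_def)
  qed
  ultimately show "\<exists>out t H. runs prog (enc_graph n es) out t \<and> t \<le> time_bound n + 2 \<and>
      represents_labeling n out H \<and> optimal_HL1 {..<n} E H"
    using t(1) by (intro exI[of _ out] exI[of _ "1 + t + 1"] exI[of _ "label_of lab"]) auto
qed

lemma time_bound_le:
  assumes "n \<ge> 3000"
  shows "real (time_bound n + 2) \<le> real n powr (226 * ln (real n))"
proof -
  define L where "L = log_bound n"
  have "1 \<le> L" using log_bound(1)[of n] assms by (cases L) (auto simp: L_def)
  then have "2 ^ (L - 1) \<le> n" using log_bound(2)[of "L - 1" n] by (simp add: L_def)
  then have "(2::real) ^ (L - 1) \<le> n" by (metis of_nat_le_iff of_nat_numeral of_nat_power)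
  then have "ln ((2::real) ^ (L - 1)) \<le> ln (real n)" using assms by (subst ln_le_cancel_iff) auto
  then have "real (L - 1) * ln 2 \<le> ln (real n)" by (simp add: ln_realpow)
  \<comment> \<open>ln 2 \<ge> 1/2 is the inequality ln x \<le> x - 1 at x = 1/2.\<close>
  moreover have "real (L - 1) * (1 / 2) \<le> real (L - 1) * ln 2"
    using ln_le_minus_one[of "1 / 2 :: real"] by (intro mult_left_mono) (auto simp: ln_div)
  ultimately have L: "real L \<le> 2 * ln (real n) + 1" using \<open>1 \<le> L\<close> by (simp add: of_nat_diff)
  have "exp 1 \<le> real n" using exp_le assms by linarith
  then have ln1: "1 \<le> ln (real n)" using assms by (subst ln_ge_iff) auto
  have "time_bound n + 2 \<le> n ^ (72 * L + 10)"
  proof -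
    have "n + 2 \<le> n ^ 2" using assms by (auto simp: power2_eq_square intro: order_trans[of _ "2 * n"])
    then have "(n + 2) ^ (36 * L + 4) \<le> (n ^ 2) ^ (36 * L + 4)" by (rule power_mono) simp
    then have "(n + 2) ^ (36 * L + 4) \<le> n ^ (72 * L + 8)" by (simp flip: power_mult)
    moreover have "1 \<le> n ^ (72 * L + 8)" using assms by simp
    ultimately have "time_bound n + 2 \<le> 3002 * n ^ (72 * L + 8)"
      unfolding time_bound_def L_def[symmetric] by linarith
    also have "\<dots> \<le> n ^ 2 * n ^ (72 * L + 8)"
    proof (rule mult_le_mono1)
      have "3000 * 3000 \<le> n * n" using assms by (intro mult_le_mono) auto
      then show "3002 \<le> n ^ 2" by (simp add: power2_eq_square)
    qed
    also have "\<dots> = n ^ (72 * L + 10)" by (simp add: add.commute flip: power_add)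
    finally show ?thesis .
  qed
  then have "real (time_bound n + 2) \<le> real n ^ (72 * L + 10)" by (metis of_nat_le_iff of_nat_power)
  also have "\<dots> = real n powr real (72 * L + 10)" using assms by (subst powr_realpow) auto
  \<comment> \<open>72 (2 ln n + 1) + 10 = 144 ln n + 82, and 82 \<le> 82 ln n because ln n \<ge>
    1.\<close>
  also have "\<dots> \<le> real n powr (226 * ln (real n))"
    using L ln1 assms by (intro powr_mono) auto
  finally show ?thesis .
qed

theorem mainTheorem9:
  shows "\<exists>(P :: program) (T :: nat \<Rightarrow> nat) (f :: nat \<Rightarrow> real).
           solves_HL1_on_trees P T \<and>
           f \<in> O(\<lambda>n. ln (real n)) \<and>
           (\<forall>\<^sub>F n in sequentially. real (T n) \<le> real n powr f n)"
proof (intro exI conjI)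
  show "solves_HL1_on_trees prog (\<lambda>n. time_bound n + 2)" using solves_prog .
  show "(\<lambda>n. 226 * ln (real n)) \<in> O(\<lambda>n. ln (real n))" by simp
  show "\<forall>\<^sub>F n in sequentially. real (time_bound n + 2) \<le> real n powr (226 * ln (real n))"
    using time_bound_le by (auto simp: eventually_sequentially)
qed

end
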